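(* Let $G$ be a graph of order $n$. Then $\phi(G)\le 10^{n/5}$. Furthermore, $\phi(G)=10^{n/5}$ if and only if $n\equiv 0\pmod 5$ and $G$ is the disjoint union of $n/5$ graphs, each of which is isomorphic to a graph obtained from $K_5$ by deleting $i$ pairwise non-adjacent edges (i.e., a matching of size $i$) for some $0\le i\le 2$.
   Context: All graphs are finite, simple, undirected and labeled. A subset $F$ of vertices of a graph $G$ is a dissociation set if the induced subgraph $G[F]$ has maximum degree at most $1$. A maximal dissociation set is a dissociation set that is not a proper subset of any other dissociation set. $\phi(G)$ denotes the number of maximal dissociation sets of $G$. *)

theory Defs
  imports Complex_Main "HOL-Library.Disjoint_Sets"
begin

definition simple_graph :: "'a set \<Rightarrow> 'a set set \<Rightarrow> bool" where
  "simple_graph V E \<longleftrightarrow> finite V \<and>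
     (\<forall>e\<in>E. \<exists>u v. e = {u, v} \<and> u \<noteq> v \<and> u \<in> V \<and> v \<in> V)"

definition dissociation_set :: "'a set \<Rightarrow> 'a set set \<Rightarrow> 'a set \<Rightarrow> bool" where
  "dissociation_set V E F \<longleftrightarrow> F \<subseteq> V \<and> (\<forall>v\<in>F. card {u\<in>F. {u, v} \<in> E} \<le> 1)"

definition maximal_dissociation_set :: "'a set \<Rightarrow> 'a set set \<Rightarrow> 'a set \<Rightarrow> bool" where
  "maximal_dissociation_set V E F \<longleftrightarrow> dissociation_set V E F \<and>
     (\<forall>F'. dissociation_set V E F' \<and> F \<subseteq> F' \<longrightarrow> F' = F)"

definition phi :: "'a set \<Rightarrow> 'a set set \<Rightarrow> nat" where
  "phi V E = card {F. maximal_dissociation_set V E F}"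

definition K5_minus_matching :: "'a set set \<Rightarrow> 'a set \<Rightarrow> bool" where
  "K5_minus_matching E X \<longleftrightarrow> card X = 5 \<and>
     (\<exists>M. M \<subseteq> {e. e \<subseteq> X \<and> card e = 2} \<and> disjoint M \<and> card M \<le> 2 \<and>
          {e\<in>E. e \<subseteq> X} = {e. e \<subseteq> X \<and> card e = 2} - M)"

end

theory Submission
  imports Defs
begin

text \<open>
  Fix the edge set and let the vertex set \<open>W\<close> vary; the bound is proved by induction on \<open>W\<close>.
  If \<open>K\<close> is a union of components of \<open>G[F]\<close> and \<open>R\<close> is its closed neighbourhood, then removing
  \<open>K\<close> from \<open>F\<close> yields a maximal dissociation set of \<open>W - R\<close>; hence at most
  \<open>10 powr ((card W - card R) / 5)\<close> sets \<open>F\<close> contain \<open>K\<close> in this way. In every nonempty graph without a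
  5-vertex component having a universal vertex, some vertex admits a list of possible local traces of
  \<open>F\<close> for which these estimates sum to strictly less than \<open>10 powr (card W / 5)\<close>: isolated and
  pendant vertices, vertices of degree at least four, then vertices of degree three with a neighbour
  inside their closed neighbourhood, vertices of degree two, and finally cubic graphs.
  Components with five vertices are counted with Sperner's bound 6 on four vertices.
\<close>

section \<open>Maximal dissociation sets and their traces\<close>

text \<open>Deleting a vertex from \<open>W\<close> multiplies the bound by 10^(-1/5), about 0.631,
  so each case needs a sum of powers of this number to stay below 1. The sets avoiding a vertex
  \<open>v\<close> use up 0.631, leaving 0.369. If \<open>v\<close> has d neighbours, none of which
  leaves \<open>cl v\<close>, the sets pairing \<open>v\<close> with a neighbour cost d *
  0.631^(d+1). This fits for d \<ge> 5. For d = 4 it is 0.4, and the failure is genuine: the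
  extremal graphs look like this. For 1 \<le> d \<le> 3 it is also too large, and the loss must be
  recovered from maximality: a vertex outside \<open>F\<close> is blocked either by two members of
  \<open>F\<close> or by a member that already has a partner in \<open>F\<close>. This empties some
  classes of sets and forces further vertices into others. Every local estimate is strict, so
  equality can only come from splitting off a component with ten maximal sets.\<close>

definition root5 :: real where
  "root5 = 10 powr (1 / 5)"

lemma root5_pos: "root5 > 0"
  by (simp add: root5_def)

lemma root5_power: "root5 ^ n = 10 powr (real n / 5)"
  by (simp add: root5_def powr_realpow [symmetric] powr_powr)

lemma root5_power5: "root5 ^ 5 = 10"
  by (simp add: root5_power)

text \<open>The value is 0.630957..., rounded up. The tightest branches leave a margin of less than
  0.6 percent, so a much coarser decimal would not do.\<close>

lemma inverse_root5_less: "inverse root5 < 0.63096"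
proof (rule ccontr)
  assume "\<not> ?thesis"
  then have "0.63096 ^ 5 \<le> inverse root5 ^ 5"
    by (intro power_mono) auto
  then show False
    by (simp add: power_inverse root5_power5) (simp add: field_simps)
qed

lemma inverse_root5_power5: "inverse root5 ^ 5 = 1 / 10"
  by (simp add: power_inverse root5_power5 field_simps)

definition mds :: "'a set set \<Rightarrow> 'a set \<Rightarrow> 'a set set" where
  "mds E W = {F. maximal_dissociation_set W E F}"

lemma phi_mds: "phi W E = card (mds E W)"
  by (simp add: phi_def mds_def)

definition nbh :: "'a set set \<Rightarrow> 'a set \<Rightarrow> 'a \<Rightarrow> 'a set" where
  "nbh E W v = {u \<in> W. {u, v} \<in> E}"

text \<open>Replacing the cardinality by equality of any two neighbours gives a first-order
  condition that suits automation.\<close>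

lemma dissociation_set_iff:
  assumes "finite W"
  shows "dissociation_set W E F \<longleftrightarrow>
    F \<subseteq> W \<and> (\<forall>v\<in>F. \<forall>x\<in>F. \<forall>y\<in>F. {x, v} \<in> E \<longrightarrow> {y, v} \<in> E \<longrightarrow> x = y)"
proof (cases "F \<subseteq> W")
  case True
  then have "finite {u \<in> F. {u, v} \<in> E}" for v
    using assms finite_subset by fastforce
  then show ?thesis
    unfolding dissociation_set_def One_nat_def by (simp add: card_le_Suc0_iff_eq) blast
qed (simp add: dissociation_set_def)

lemma mdsD:
  assumes "F \<in> mds E W"
  shows "F \<subseteq> W" and "dissociation_set W E F"
    and "\<And>F'. dissociation_set W E F' \<Longrightarrow> F \<subseteq> F' \<Longrightarrow> F' = F"
  using assms by (auto simp: mds_def maximal_dissociation_set_def dissociation_set_def)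

lemma mdsI:
  assumes "dissociation_set W E F"
    and "\<And>F'. dissociation_set W E F' \<Longrightarrow> F \<subseteq> F' \<Longrightarrow> F' = F"
  shows "F \<in> mds E W"
  using assms by (auto simp: mds_def maximal_dissociation_set_def)

lemma finite_mds: "finite W \<Longrightarrow> finite (mds E W)"
  by (rule finite_subset [of _ "Pow W"]) (auto dest: mdsD(1))

lemma mds_antichain: "F \<in> mds E W \<Longrightarrow> F' \<in> mds E W \<Longrightarrow> F \<subseteq> F' \<Longrightarrow> F = F'"
  by (metis mdsD(2,3))

lemma dissociation_set_subset:
  assumes "finite W" "dissociation_set W E F" "F' \<subseteq> F" "F' \<subseteq> W'" "finite W'"
  shows "dissociation_set W' E F'"
  using assms(2-4) unfolding dissociation_set_iff [OF assms(1)] dissociation_set_iff [OF assms(5)]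
  by blast

text \<open>No edge joins \<open>K\<close> to \<open>W - R\<close>, so a dissociation set properly
  extending \<open>F - K\<close> inside \<open>W - R\<close> would, together with \<open>K\<close>,
  properly extend \<open>F\<close>. Since \<open>K\<close> is fixed, \<open>F - K\<close> determines
  \<open>F\<close>. Taking \<open>K\<close> empty covers plain deletion of vertices.\<close>

lemma card_mds_trace_le:
  assumes fin: "finite W" and "K \<subseteq> R" "R \<subseteq> W"
    and cl: "\<And>k. k \<in> K \<Longrightarrow> nbh E W k \<subseteq> R"
  shows "card {F \<in> mds E W. F \<inter> R = K} \<le> phi (W - R) E"
proof -
  have "(\<lambda>F. F - K) ` {F \<in> mds E W. F \<inter> R = K} \<subseteq> mds E (W - R)"
  proof clarify
    fix F assume F: "F \<in> mds E W" and K: "K = F \<inter> R"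
    show "F - F \<inter> R \<in> mds E (W - R)"
    proof (rule mdsI)
      show "dissociation_set (W - R) E (F - F \<inter> R)"
        by (rule dissociation_set_subset [OF fin mdsD(2) [OF F]])
          (use fin mdsD(1) [OF F] in auto)
      fix F' assume F': "dissociation_set (W - R) E F'" "F - F \<inter> R \<subseteq> F'"
      have sub: "F' \<subseteq> W - R"
        using F'(1) by (simp add: dissociation_set_def)
      have noedge: "{x, y} \<notin> E \<and> {y, x} \<notin> E" if "x \<in> K" "y \<in> F'" for x y
        using cl [of x] sub that by (auto simp: nbh_def insert_commute)
      have "dissociation_set W E (F' \<union> K)"
        unfolding dissociation_set_iff [OF fin]
      proof (intro conjI ballI impI)
        show "F' \<union> K \<subseteq> W" using sub mdsD(1) [OF F] K by auto
        fix v x y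
        assume "v \<in> F' \<union> K" "x \<in> F' \<union> K" "y \<in> F' \<union> K" "{x, v} \<in> E" "{y, v} \<in> E"
        then have "v \<in> F' \<and> x \<in> F' \<and> y \<in> F' \<or> v \<in> F \<and> x \<in> F \<and> y \<in> F"
          using noedge K by blast
        then show "x = y"
          using mdsD(2) [OF F] F'(1) \<open>{x, v} \<in> E\<close> \<open>{y, v} \<in> E\<close> fin
          by (metis dissociation_set_iff finite_Diff)
      qed
      then have "F' \<union> K = F"
        using mdsD(3) [OF F] F'(2) K by blast
      then show "F' = F - F \<inter> R" using sub K by blast
    qed
  qed
  moreover have "inj_on (\<lambda>F. F - K) {F \<in> mds E W. F \<inter> R = K}"
    by (auto simp: inj_on_def)
  ultimately show ?thesis
    unfolding phi_mds using fin by (intro card_inj_on_le finite_mds) auto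
qed

lemma card_not_mem_mds_le:
  assumes "finite W" "v \<in> W"
  shows "card {F \<in> mds E W. v \<notin> F} \<le> phi (W - {v}) E"
proof -
  have "{F \<in> mds E W. v \<notin> F} = {F \<in> mds E W. F \<inter> {v} = {}}" by auto
  then show ?thesis
    using card_mds_trace_le [OF assms(1), of "{}" "{v}"] assms(2) by auto
qed

text \<open>Adding \<open>v\<close> to \<open>F\<close> creates a vertex of degree two either at
  \<open>v\<close> itself or at a neighbour of \<open>v\<close> that already has a neighbour in
  \<open>F\<close>.\<close>

lemma mds_blocked:
  assumes fin: "finite W" and F: "F \<in> mds E W" and v: "v \<in> W" "v \<notin> F" "{v} \<notin> E"
  obtains (two) u u' where "u \<in> nbh E W v \<inter> F" "u' \<in> nbh E W v \<inter> F" "u \<noteq> u'"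
  | (partner) u w where "u \<in> nbh E W v \<inter> F" "w \<in> nbh E W u \<inter> F"
proof -
  have "\<not> dissociation_set W E (insert v F)"
    using mdsD(3) [OF F] v by blast
  then obtain z x y where xyz: "z \<in> insert v F" "x \<in> insert v F" "y \<in> insert v F"
    "{x, z} \<in> E" "{y, z} \<in> E" "x \<noteq> y"
    using mdsD(1) [OF F] v(1) unfolding dissociation_set_iff [OF fin] by blast
  have sub: "F \<subseteq> W" by (rule mdsD(1) [OF F])
  show ?thesis
  proof (cases "z = v")
    case True
    then have "x \<noteq> v" "y \<noteq> v" using xyz v by auto
    then show ?thesis
      using two [of x y] xyz sub True by (auto simp: nbh_def)
  next
    case False
    then have "z \<in> F" using xyz by simp
    then have "x = v \<or> y = v"
      using mdsD(2) [OF F] xyz by (auto simp: dissociation_set_iff [OF fin])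
    then obtain w where "w \<in> F" "{w, z} \<in> E" "{v, z} \<in> E"
      using xyz by auto
    then show ?thesis
      using partner [of z w] \<open>z \<in> F\<close> sub by (auto simp: nbh_def insert_commute)
  qed
qed

section \<open>Branching\<close>

locale graph_edges =
  fixes E :: "'a set set"
  assumes edgeD: "e \<in> E \<Longrightarrow> \<exists>u v. e = {u, v} \<and> u \<noteq> v"
begin

lemma no_loop [simp]: "{v} \<notin> E"
  using edgeD [of "{v}"] by (auto simp: doubleton_eq_iff)

end

locale branching = graph_edges E for E :: "'a set set" +
  fixes W :: "'a set"
  assumes fin: "finite W"
    and smaller: "\<And>W'. W' \<subset> W \<Longrightarrow> real (phi W' E) \<le> root5 ^ card W'"
begin

abbreviation M :: "'a set set" where "M \<equiv> mds E W"
abbreviation N :: "'a \<Rightarrow> 'a set" where "N \<equiv> nbh E W"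
abbreviation cl :: "'a \<Rightarrow> 'a set" where "cl v \<equiv> insert v (N v)"

text \<open>\<open>wt r\<close> bounds the number of maximal dissociation sets left after deleting \<open>r\<close> vertices from \<open>W\<close>.\<close>
definition wt :: "nat \<Rightarrow> real" where
  "wt k = root5 ^ card W * inverse root5 ^ k"

text \<open>The sets in which \<open>v\<close>, respectively the edge \<open>uv\<close>, is a component of the induced subgraph.\<close>
definition solo :: "'a \<Rightarrow> 'a set set" where
  "solo v = {F \<in> M. F \<inter> cl v = {v}}"

definition duo :: "'a \<Rightarrow> 'a \<Rightarrow> 'a set set" where
  "duo u v = {F \<in> M. F \<inter> (cl u \<union> cl v) = {u, v}}"

lemma wt_pos: "wt k > 0"
  by (simp add: wt_def root5_pos)

lemma wt_Suc: "wt (Suc k) = inverse root5 * wt k"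
  by (simp add: wt_def)

lemma wt_Suc_le: "wt (Suc k) \<le> 63096 / 100000 * wt k"
  unfolding wt_Suc using inverse_root5_less wt_pos [of k] by (intro mult_right_mono) auto

text \<open>Powers of 0.63096 rounded up. The value at 5 is exact, and those at 6 and 7 start from
  it, so rounding errors do not accumulate.\<close>

lemma wt_bounds:
  "wt 1 \<le> 63096 / 100000 * wt 0" "wt 2 \<le> 39812 / 100000 * wt 0" "wt 3 \<le> 2512 / 10000 * wt 0"
  "wt 4 \<le> 1585 / 10000 * wt 0" "wt 5 = 1 / 10 * wt 0" "wt 6 \<le> 631 / 10000 * wt 0" "wt 7 \<le> 3982 / 100000 * wt 0"
proof -
  show 5: "wt 5 = 1 / 10 * wt 0" by (simp add: wt_def inverse_root5_power5)
  show 1: "wt 1 \<le> 63096 / 100000 * wt 0" using wt_Suc_le [of 0] by simp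
  show 2: "wt 2 \<le> 39812 / 100000 * wt 0"
    using wt_Suc_le [of 1] 1 wt_pos [of 0] by (simp add: numeral_eq_Suc)
  show 3: "wt 3 \<le> 2512 / 10000 * wt 0"
    using wt_Suc_le [of 2] wt_Suc_le [of 1] 1 wt_pos [of 0] by (simp add: numeral_eq_Suc)
  show "wt 4 \<le> 1585 / 10000 * wt 0"
    using wt_Suc_le [of 3] wt_Suc_le [of 2] wt_Suc_le [of 1] 1 wt_pos [of 0]
    by (simp add: numeral_eq_Suc)
  show 6: "wt 6 \<le> 631 / 10000 * wt 0"
    using wt_Suc_le [of 5] 5 wt_pos [of 0] by simp
  show "wt 7 \<le> 3982 / 100000 * wt 0"
    using wt_Suc_le [of 6] wt_Suc_le [of 5] 5 wt_pos [of 0] by simp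
qed

lemma wt_mono: "k \<le> l \<Longrightarrow> wt l \<le> wt k"
proof (rule lift_Suc_antimono_le [of wt])
  show "wt (Suc n) \<le> wt n" for n
    using wt_Suc_le [of n] wt_pos [of n] by linarith
qed

lemma N_sub: "N v \<subseteq> W" and finN [simp]: "finite (N v)" and not_in_N [simp]: "v \<notin> N v"
  and N_sym: "u \<in> N v \<Longrightarrow> v \<in> W \<Longrightarrow> v \<in> N u"
  using fin by (auto simp: nbh_def insert_commute)

lemma phi_minus_le:
  assumes "R \<subseteq> W" "0 < r" "r \<le> card R"
  shows "real (phi (W - R) E) \<le> wt r"
proof -
  have "R \<noteq> {}" using assms(2,3) by auto
  then have "W - R \<subset> W" using assms(1) by blast
  then have "real (phi (W - R) E) \<le> root5 ^ card (W - R)" by (rule smaller)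
  also have "root5 ^ card (W - R) = wt (card R)"
  proof -
    have "card (W - R) = card W - card R" and "card R \<le> card W"
      using fin assms(1) by (simp_all add: card_Diff_subset finite_subset card_mono)
    then show ?thesis
      using root5_pos by (simp add: wt_def power_diff field_simps)
  qed
  also have "\<dots> \<le> wt r" by (rule wt_mono) fact
  finally show ?thesis .
qed

lemma trace_le:
  assumes "K \<subseteq> R" "R \<subseteq> W" "\<And>k. k \<in> K \<Longrightarrow> N k \<subseteq> R" "0 < r" "r \<le> card R"
    and "X \<subseteq> {F \<in> M. F \<inter> R = K}"
  shows "real (card X) \<le> wt r"
proof -
  have "card X \<le> card {F \<in> M. F \<inter> R = K}"
    using assms(6) finite_mds [OF fin, of E] by (intro card_mono) auto
  also have "\<dots> \<le> phi (W - R) E"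
    by (rule card_mds_trace_le [OF fin assms(1-3)])
  finally show ?thesis
    using phi_minus_le [OF assms(2,4,5)] by linarith
qed

lemma solo_le: "v \<in> W \<Longrightarrow> r \<le> Suc (card (N v)) \<Longrightarrow> 0 < r \<Longrightarrow> real (card (solo v)) \<le> wt r"
  by (rule trace_le [of "{v}" "cl v"]) (use N_sub in \<open>auto simp: solo_def\<close>)

lemma duo_le:
  "v \<in> W \<Longrightarrow> u \<in> N v \<Longrightarrow> r \<le> card (cl u \<union> cl v) \<Longrightarrow> 0 < r \<Longrightarrow> real (card (duo u v)) \<le> wt r"
proof (rule trace_le [of "{u, v}" "cl u \<union> cl v"])
  show "v \<in> W \<Longrightarrow> u \<in> N v \<Longrightarrow> cl u \<union> cl v \<subseteq> W"
    using N_sub by blast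
qed (auto simp: duo_def)

lemma duo_comm: "duo u v = duo v u"
  unfolding duo_def by (simp add: insert_commute Un_commute)

lemma finite_duo [simp]: "finite (duo u v)" and finite_solo [simp]: "finite (solo u)"
  using finite_mds [OF fin, of E] by (auto simp: duo_def solo_def)

lemma duoI:
  assumes F: "F \<in> M" and "u \<in> F" "w \<in> F" "u \<in> N w"
  shows "F \<in> duo u w"
proof -
  have *: "\<forall>v\<in>F. \<forall>x\<in>F. \<forall>y\<in>F. {x, v} \<in> E \<longrightarrow> {y, v} \<in> E \<longrightarrow> x = y"
    using mdsD(2) [OF F] by (simp add: dissociation_set_iff [OF fin])
  have "F \<inter> (cl u \<union> cl w) \<subseteq> {u, w}"
  proof
    fix x assume x: "x \<in> F \<inter> (cl u \<union> cl w)"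
    then show "x \<in> {u, w}"
      using assms * by (auto simp: nbh_def insert_commute)
  qed
  then show ?thesis
    using assms by (auto simp: duo_def)
qed

lemma mem_cases:
  assumes "F \<in> M" "v \<in> F"
  shows "F \<in> solo v \<or> (\<exists>u\<in>N v. F \<in> duo u v)"
proof (cases "N v \<inter> F = {}")
  case True
  then show ?thesis using assms by (auto simp: solo_def)
next
  case False
  then show ?thesis using assms duoI [of F _ v] by blast
qed

text \<open>If no neighbour of \<open>v\<close> in \<open>F\<close> has a partner, then all of them
  are isolated in the graph induced by \<open>F\<close>, and blocking \<open>v\<close> takes two of
  them.\<close>

lemma not_mem_cases:
  assumes F: "F \<in> M" and v: "v \<in> W" "v \<notin> F"
  shows "(\<exists>u\<in>N v. \<exists>w\<in>N u - {v}. F \<in> duo u w) \<or> (\<exists>u\<in>N v. \<exists>u'\<in>N v. u \<noteq> u' \<and> F \<in> solo u \<inter> solo u')"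
proof -
  have partner: ?thesis if "u \<in> N v \<inter> F" "w \<in> N u \<inter> F" for u w
    using that v duoI [OF F, of w u] by (auto simp: duo_comm)
  from fin F v no_loop show ?thesis
  proof (cases rule: mds_blocked)
    case (two u u')
    have "F \<in> solo x \<or> (\<exists>w. w \<in> N x \<inter> F)" if "x \<in> F" for x
      using mem_cases [OF F that] by (auto simp: duo_def)
    then show ?thesis
      using two partner by (metis Int_iff)
  qed (use partner in blast)
qed

text \<open>Something must block \<open>u\<close>. Of two neighbours in \<open>F\<close>, one
  differs from \<open>v\<close>; a neighbour with a partner differs from \<open>v\<close> because
  \<open>v\<close> is alone. Such a vertex lies outside \<open>cl v\<close>, which \<open>F\<close>
  meets only in \<open>v\<close>.\<close>

lemma solo_outside:
  assumes F: "F \<in> solo v" and v: "v \<in> W" and u: "u \<in> N v"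
  shows "\<exists>w\<in>N u - cl v. w \<in> F"
proof -
  have FM: "F \<in> M" and Fv: "F \<inter> cl v = {v}" using F by (auto simp: solo_def)
  have out: ?thesis if "w \<in> N u" "w \<in> F" "w \<noteq> v" for w
    using that Fv by (intro bexI [of _ w]) auto
  have uv: "u \<noteq> v" using u by auto
  then have uF: "u \<notin> F" "u \<in> W" using Fv u N_sub [of v] by auto
  from fin FM uF(2,1) no_loop show ?thesis
  proof (cases rule: mds_blocked)
    case (two x y)
    then show ?thesis using out [of x] out [of y] by auto
  next
    case (partner x y)
    have "y = v" if "x = v" using that partner Fv by auto
    then have "x \<noteq> v" using partner not_in_N [of x] by auto
    then show ?thesis using partner out [of x] by auto
  qed
qed

lemma phi_split:
  assumes "v \<in> W"
  shows "real (phi W E) \<le> real (card {F \<in> M. v \<notin> F}) + real (card (solo v)) + (\<Sum>u\<in>N v. real (card (duo u v)))"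
proof -
  have "M \<subseteq> {F \<in> M. v \<notin> F} \<union> solo v \<union> (\<Union>u\<in>N v. duo u v)"
    using mem_cases [of _ v] by blast
  then have "card M \<le> card ({F \<in> M. v \<notin> F} \<union> solo v \<union> (\<Union>u\<in>N v. duo u v))"
    using finite_mds [OF fin, of E] by (intro card_mono) auto
  also have "\<dots> \<le> card {F \<in> M. v \<notin> F} + card (solo v) + card (\<Union>u\<in>N v. duo u v)"
    by (meson add_mono card_Un_le le_refl le_trans)
  also have "\<dots> \<le> card {F \<in> M. v \<notin> F} + card (solo v) + (\<Sum>u\<in>N v. card (duo u v))"
    by (simp add: card_UN_le)
  finally show ?thesis
    unfolding phi_mds of_nat_sum [symmetric] of_nat_add [symmetric] of_nat_le_iff .
qed

end

section \<open>Branching at a single vertex\<close>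

context branching
begin

text \<open>For \<open>n\<close> at least 2, (n+1)/n is at most 3/2, and 1.5 * 0.63096 < 1.\<close>

lemma wt_ratio: "2 \<le> n \<Longrightarrow> real (Suc n) * wt (Suc m) \<le> real n * wt m"
proof -
  assume "2 \<le> n"
  have "real (Suc n) * wt (Suc m) \<le> real (Suc n) * (63096 / 100000 * wt m)"
    using wt_Suc_le by (rule mult_left_mono) simp
  also have "\<dots> = (real (Suc n) * (63096 / 100000)) * wt m" by simp
  also have "\<dots> \<le> real n * wt m"
    using \<open>2 \<le> n\<close> wt_pos [of m] by (intro mult_right_mono) auto
  finally show ?thesis .
qed

text \<open>The product is the cost of \<open>n\<close> choices that each remove
  \<open>n + i\<close> vertices; its monotonicity reduces unbounded degrees to the smallest
  one.\<close>

lemma mult_wt_antimono: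
  assumes "k \<le> n" "2 \<le> k"
  shows "real n * wt (n + i) \<le> real k * wt (k + i)"
  using assms(1)
proof (induction n rule: dec_induct)
  case (step n)
  then show ?case using wt_ratio [of n "n + i"] assms(2) by simp
qed simp

text \<open>
  If \<open>v\<close> is a component of \<open>F\<close>, then each neighbour of \<open>v\<close> is blocked by a vertex outside \<open>cl v\<close>;
  so \<open>solo v\<close> is empty unless \<open>k = d\<close>.
\<close>
lemma phi_branch:
  assumes v: "v \<in> W" and ne: "N v \<noteq> {}"
    and d: "card (N v) = d" and k: "card {u \<in> N v. \<not> N u \<subseteq> cl v} = k"
  shows "real (phi W E) \<le> real (phi (W - {v}) E) + (if k = d then wt (d + 1) else 0)
    + real (d - k) * wt (d + 1) + real k * wt (d + 2)" and "k \<le> d"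
proof -
  let ?O = "{u \<in> N v. \<not> N u \<subseteq> cl v}"
  show "k \<le> d"
    unfolding d [symmetric] k [symmetric] by (intro card_mono) auto
  have solo: "real (card (solo v)) \<le> (if k = d then wt (d + 1) else 0)"
  proof (cases "k = d")
    case True
    then show ?thesis using solo_le [OF v, of "d + 1"] d by simp
  next
    case False
    then have "?O \<noteq> N v" using d k by metis
    then obtain u where u: "u \<in> N v" "N u \<subseteq> cl v" by blast
    have "solo v = {}"
    proof (rule equals0I)
      fix F assume "F \<in> solo v"
      from solo_outside [OF this v u(1)] u(2) show False by blast
    qed
    then show ?thesis using False by simp
  qed
  have in_le: "real (card (duo u v)) \<le> wt (d + 1)" if "u \<in> N v" for u
  proof (rule duo_le [OF v that])
    have "card (cl v) \<le> card (cl u \<union> cl v)" by (intro card_mono) auto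
    then show "d + 1 \<le> card (cl u \<union> cl v)" using d by simp
  qed simp
  have out_le: "real (card (duo u v)) \<le> wt (d + 2)" if "u \<in> ?O" for u
  proof (rule duo_le [OF v])
    have "card (cl v) < card (cl u \<union> cl v)" using that by (intro psubset_card_mono) auto
    then show "d + 2 \<le> card (cl u \<union> cl v)" using d by simp
  qed (use that in auto)
  have "(\<Sum>u\<in>N v. real (card (duo u v))) = (\<Sum>u\<in>N v - ?O. real (card (duo u v))) + (\<Sum>u\<in>?O. real (card (duo u v)))"
    by (intro sum.subset_diff) auto
  also have "\<dots> \<le> (\<Sum>u\<in>N v - ?O. wt (d + 1)) + (\<Sum>u\<in>?O. wt (d + 2))"
    by (intro add_mono sum_mono in_le out_le) auto
  also have "\<dots> = real (d - k) * wt (d + 1) + real k * wt (d + 2)"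
  proof -
    have "card (N v - ?O) = d - k" unfolding d [symmetric] k [symmetric]
      by (rule card_Diff_subset) auto
    then show ?thesis by (simp add: k)
  qed
  finally show "real (phi W E) \<le> real (phi (W - {v}) E) + (if k = d then wt (d + 1) else 0)
    + real (d - k) * wt (d + 1) + real k * wt (d + 2)"
    using phi_split [OF v] solo card_not_mem_mds_le [OF fin v, of E] by linarith
qed

lemma phi_del_le: "v \<in> W \<Longrightarrow> real (phi (W - {v}) E) \<le> wt 1"
  by (rule phi_minus_le) auto

section \<open>Vertices of degree at most one or at least four\<close>

lemma phi_less_isolated:
  assumes v: "v \<in> W" and "N v = {}"
  shows "real (phi W E) < wt 0"
proof -
  have "M \<subseteq> solo v"
    using mem_cases [of _ v] not_mem_cases [OF _ v] assms(2) by blast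
  then have "real (phi W E) \<le> real (card (solo v))"
    unfolding phi_mds by (simp add: card_mono)
  also have "\<dots> \<le> wt 1" by (rule solo_le [OF v]) auto
  finally show ?thesis using wt_bounds(1) wt_pos [of 0] by linarith
qed

text \<open>If \<open>w\<close> is not alone in \<open>F\<close>, then \<open>u\<close> lies in
  \<open>F\<close> with a partner: it is either the partner of \<open>w\<close> or the only possible
  blocker of \<open>w\<close>. The worst degree of \<open>u\<close> is two, with 0.39812 + 2 *
  0.2512 = 0.90052. An explicit factor is stated, rather than strictness, because the bound is later
  applied after a deletion to improve \<open>wt 1\<close>.\<close>

lemma phi_pendant:
  assumes w: "w \<in> W" and "card (N w) = 1"
  shows "real (phi W E) \<le> 901 / 1000 * wt 0"
proof -
  obtain u where Nw: "N w = {u}" using assms(2) by (rule card_1_singletonE)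
  then have u: "u \<in> W" using N_sub [of w] by auto
  have wu: "w \<in> N u" using N_sym [of u w] Nw w by simp
  define D where "D = card (N u)"
  have "D \<noteq> 0" using wu by (auto simp: D_def)
  have "M \<subseteq> solo w \<union> (\<Union>t\<in>N u. duo t u)"
  proof
    fix F assume F: "F \<in> M"
    show "F \<in> solo w \<union> (\<Union>t\<in>N u. duo t u)"
    proof (cases "w \<in> F")
      case True
      then show ?thesis using mem_cases [OF F True] Nw wu by (auto simp: duo_comm)
    next
      case False
      then show ?thesis using not_mem_cases [OF F w False] Nw by (auto simp: duo_comm)
    qed
  qed
  then have "card M \<le> card (solo w \<union> (\<Union>t\<in>N u. duo t u))"
    by (intro card_mono) auto
  also have "\<dots> \<le> card (solo w) + (\<Sum>t\<in>N u. card (duo t u))"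
    using card_Un_le [of "solo w" "\<Union>t\<in>N u. duo t u"] card_UN_le [of "N u" "\<lambda>t. duo t u"]
    by simp
  finally have "real (phi W E) \<le> real (card (solo w)) + (\<Sum>t\<in>N u. real (card (duo t u)))"
    unfolding phi_mds of_nat_sum [symmetric] of_nat_add [symmetric] of_nat_le_iff .
  also have "\<dots> \<le> wt 2 + (\<Sum>t\<in>N u. wt (D + 1))"
  proof (intro add_mono sum_mono)
    show "real (card (solo w)) \<le> wt 2" using solo_le [OF w, of 2] assms(2) by simp
    fix t assume "t \<in> N u"
    show "real (card (duo t u)) \<le> wt (D + 1)"
    proof (rule duo_le [OF u \<open>t \<in> N u\<close>])
      have "card (cl u) \<le> card (cl t \<union> cl u)" by (intro card_mono) auto
      then show "D + 1 \<le> card (cl t \<union> cl u)" by (simp add: D_def)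
    qed simp
  qed
  also have "\<dots> = wt 2 + real D * wt (D + 1)" by (simp add: D_def)
  finally have 1: "real (phi W E) \<le> wt 2 + real D * wt (D + 1)" .
  show ?thesis
  proof (cases "D = 1")
    case True
    then show ?thesis using 1 wt_bounds(2) wt_pos [of 0] by (simp add: numeral_2_eq_2)
  next
    case False
    then have "real D * wt (D + 1) \<le> 2 * wt 3"
      using \<open>D \<noteq> 0\<close> mult_wt_antimono [of 2 D 1] by (simp add: numeral_3_eq_3 numeral_2_eq_2)
    then show ?thesis using 1 wt_bounds(2,3) wt_pos [of 0] by linarith
  qed
qed

text \<open>For degree four with no neighbour leaving \<open>cl v\<close> the estimate would be
  0.631 + 4 * 0.1 > 1; \<open>out\<close> excludes exactly this. A single leaving neighbour already
  brings it down to about 0.994.\<close>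

lemma phi_less_high_degree:
  assumes v: "v \<in> W" and d: "4 \<le> card (N v)" and out: "card (N v) = 4 \<Longrightarrow> \<exists>u\<in>N v. \<not> N u \<subseteq> cl v"
  shows "real (phi W E) < wt 0"
proof -
  define d where "d = card (N v)"
  define k where "k = card {u \<in> N v. \<not> N u \<subseteq> cl v}"
  have ne: "N v \<noteq> {}" using d by auto
  note branch = phi_branch [OF v ne d_def [symmetric] k_def [symmetric]]
  have le: "real (phi W E) \<le> wt 1 + (if k = d then wt (d + 1) else 0)
    + real (d - k) * wt (d + 1) + real k * wt (d + 2)"
    using branch(1) phi_del_le [OF v] by linarith
  note wb = wt_bounds wt_pos [of 0]
  consider "d \<ge> 6" | "d = 5" | "d = 4" using d unfolding d_def [symmetric] by linarith
  then show ?thesis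
  proof cases
    case 1
    \<comment> \<open>For d \<ge> 6 the value of \<open>k\<close> is irrelevant: at most d + 1 terms
      \<open>wt (d + 1)\<close> occur besides \<open>wt 1\<close>, and their sum is largest at d =
      6, giving about 0.91.\<close>
    have "real k * wt (d + 2) \<le> real k * wt (d + 1)"
      by (intro mult_left_mono wt_mono) auto
    moreover have "real (d - k) * wt (d + 1) + real k * wt (d + 1) = real d * wt (d + 1)"
      using branch(2) by (simp add: of_nat_diff algebra_simps)
    moreover have "real (Suc d) * wt (d + 1) = real d * wt (d + 1) + wt (d + 1)"
      by (simp add: algebra_simps)
    moreover have "real (Suc d) * wt (d + 1) \<le> 7 * wt 7"
      using mult_wt_antimono [of 7 "Suc d" 0] 1 by simp
    ultimately show ?thesis using le wb wt_pos [of "d + 1"] by (simp split: if_splits)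
  next
    case 2
    then have "k = 0 \<or> k = 1 \<or> k = 2 \<or> k = 3 \<or> k = 4 \<or> k = 5" using branch(2) by linarith
    then show ?thesis using le wb 2 by (elim disjE) simp_all
  next
    case 3
    have "k \<noteq> 0" using out 3 by (auto simp: k_def d_def)
    then have "k = 1 \<or> k = 2 \<or> k = 3 \<or> k = 4" using branch(2) 3 by linarith
    then show ?thesis using le wb 3 by (elim disjE) simp_all
  qed
qed

end

section \<open>Components\<close>

lemma dissociation_set_Un:
  assumes "finite C" "finite D" "C \<inter> D = {}" and no: "\<And>x y. x \<in> C \<Longrightarrow> y \<in> D \<Longrightarrow> {x, y} \<notin> E"
  shows "dissociation_set (C \<union> D) E F \<longleftrightarrow>
    F \<subseteq> C \<union> D \<and> dissociation_set C E (F \<inter> C) \<and> dissociation_set D E (F \<inter> D)"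
proof -
  have fin: "finite (C \<union> D)" using assms(1,2) by simp
  have no': "x \<in> C \<Longrightarrow> y \<in> D \<Longrightarrow> {y, x} \<notin> E" for x y
    using no by (simp add: insert_commute)
  show ?thesis
  proof (intro iffI conjI; (elim conjE)?)
    assume F: "dissociation_set (C \<union> D) E F"
    then show "F \<subseteq> C \<union> D" by (simp add: dissociation_set_def)
    show "dissociation_set C E (F \<inter> C)" "dissociation_set D E (F \<inter> D)"
      using dissociation_set_subset [OF fin F] assms(1,2) by auto
  next
    assume sub: "F \<subseteq> C \<union> D"
      and d: "dissociation_set C E (F \<inter> C)" "dissociation_set D E (F \<inter> D)"
    show "dissociation_set (C \<union> D) E F"
      unfolding dissociation_set_iff [OF fin]
    proof (intro conjI sub ballI impI)
      fix v x y
      assume F: "v \<in> F" "x \<in> F" "y \<in> F" and e: "{x, v} \<in> E" "{y, v} \<in> E"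
      consider "v \<in> C" | "v \<in> D" using sub F(1) by blast
      then show "x = y"
      proof cases
        case 1
        then have "x \<in> C" "y \<in> C" using no' [OF 1] e sub F by blast+
        then show ?thesis using d(1) 1 F e unfolding dissociation_set_iff [OF assms(1)] by blast
      next
        case 2
        then have "x \<in> D" "y \<in> D" using no [OF _ 2] e sub F by blast+
        then show ?thesis using d(2) 2 F e unfolding dissociation_set_iff [OF assms(2)] by blast
      qed
    qed
  qed
qed

lemma phi_Un:
  assumes fin: "finite C" "finite D" and disj: "C \<inter> D = {}"
    and no: "\<And>x y. x \<in> C \<Longrightarrow> y \<in> D \<Longrightarrow> {x, y} \<notin> E"
  shows "phi (C \<union> D) E = phi C E * phi D E"
proof -
  have Un: "dissociation_set (C \<union> D) E F \<longleftrightarrow>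
    F \<subseteq> C \<union> D \<and> dissociation_set C E (F \<inter> C) \<and> dissociation_set D E (F \<inter> D)" for F
    using fin disj no by (rule dissociation_set_Un)
  have split: "F = (F \<inter> C) \<union> (F \<inter> D)" if "F \<in> mds E (C \<union> D)" for F
    using mdsD(1) [OF that] by blast
  have "bij_betw (\<lambda>F. (F \<inter> C, F \<inter> D)) (mds E (C \<union> D)) (mds E C \<times> mds E D)"
  proof (rule bij_betw_byWitness [where f' = "\<lambda>(X, Y). X \<union> Y"])
    show "\<forall>F\<in>mds E (C \<union> D). (case (F \<inter> C, F \<inter> D) of (X, Y) \<Rightarrow> X \<union> Y) = F"
      using split by auto
    show "\<forall>a\<in>mds E C \<times> mds E D. ((case a of (X, Y) \<Rightarrow> X \<union> Y) \<inter> C, (case a of (X, Y) \<Rightarrow> X \<union> Y) \<inter> D) = a"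
      using disj by (auto dest!: mdsD(1))
    show "(\<lambda>F. (F \<inter> C, F \<inter> D)) ` mds E (C \<union> D) \<subseteq> mds E C \<times> mds E D"
    proof clarify
      fix F assume F: "F \<in> mds E (C \<union> D)"
      have d: "dissociation_set C E (F \<inter> C)" "dissociation_set D E (F \<inter> D)"
        using mdsD(2) [OF F] Un by auto
      have "F \<inter> C \<in> mds E C"
      proof (rule mdsI [OF d(1)])
        fix X assume X: "dissociation_set C E X" "F \<inter> C \<subseteq> X"
        then have "X \<subseteq> C" by (simp add: dissociation_set_def)
        then have "(X \<union> F \<inter> D) \<inter> C = X" "(X \<union> F \<inter> D) \<inter> D = F \<inter> D" using disj by auto
        then have "dissociation_set (C \<union> D) E (X \<union> F \<inter> D)"
          using X d \<open>X \<subseteq> C\<close> by (auto simp: Un)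
        then have "X \<union> F \<inter> D = F" using mdsD(3) [OF F] split [OF F] X(2) by blast
        then show "X = F \<inter> C" using \<open>X \<subseteq> C\<close> disj by blast
      qed
      moreover have "F \<inter> D \<in> mds E D"
      proof (rule mdsI [OF d(2)])
        fix X assume X: "dissociation_set D E X" "F \<inter> D \<subseteq> X"
        then have "X \<subseteq> D" by (simp add: dissociation_set_def)
        then have "(X \<union> F \<inter> C) \<inter> D = X" "(X \<union> F \<inter> C) \<inter> C = F \<inter> C" using disj by auto
        then have "dissociation_set (C \<union> D) E (X \<union> F \<inter> C)"
          using X d \<open>X \<subseteq> D\<close> by (auto simp: Un)
        then have "X \<union> F \<inter> C = F" using mdsD(3) [OF F] split [OF F] X(2) by blast
        then show "X = F \<inter> D" using \<open>X \<subseteq> D\<close> disj by blast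
      qed
      ultimately show "F \<inter> C \<in> mds E C \<and> F \<inter> D \<in> mds E D" ..
    qed
    show "(\<lambda>(X, Y). X \<union> Y) ` (mds E C \<times> mds E D) \<subseteq> mds E (C \<union> D)"
    proof clarify
      fix X Y assume X: "X \<in> mds E C" and Y: "Y \<in> mds E D"
      have XY: "(X \<union> Y) \<inter> C = X" "(X \<union> Y) \<inter> D = Y"
        using mdsD(1) [OF X] mdsD(1) [OF Y] disj by auto
      show "X \<union> Y \<in> mds E (C \<union> D)"
      proof (rule mdsI)
        show "dissociation_set (C \<union> D) E (X \<union> Y)"
          unfolding Un XY using mdsD(1,2) [OF X] mdsD(1,2) [OF Y] by auto
        fix F assume F: "dissociation_set (C \<union> D) E F" "X \<union> Y \<subseteq> F"
        then have "F \<inter> C = X" "F \<inter> D = Y"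
          using mdsD(3) [OF X, of "F \<inter> C"] mdsD(3) [OF Y, of "F \<inter> D"]
            mdsD(1) [OF X] mdsD(1) [OF Y] by (auto simp: Un)
        then show "F = X \<union> Y" using F(1) unfolding Un by blast
      qed
    qed
  qed
  then show ?thesis
    unfolding phi_mds by (simp add: bij_betw_same_card card_cartesian_product)
qed

section \<open>Counting on four and five vertices\<close>

context graph_edges
begin

text \<open>Two vertices always form a dissociation set, and without dissociation triples nothing
  larger is one, so the pairs are exactly the maximal sets.\<close>

lemma mds_eq_pairs:
  assumes fin: "finite W" and two: "2 \<le> card W"
    and no3: "\<And>T. T \<subseteq> W \<Longrightarrow> card T = 3 \<Longrightarrow> \<not> dissociation_set W E T"
  shows "mds E W = {F. F \<subseteq> W \<and> card F = 2}"
proof -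
  have pair: "dissociation_set W E F" if F: "F \<subseteq> W" "card F = 2" for F
  proof -
    obtain x y where "F = {x, y}" using F(2) by (auto simp: card_2_iff)
    then show ?thesis using F(1) by (auto simp: dissociation_set_iff [OF fin])
  qed
  have small: "card F \<le> 2" if F: "dissociation_set W E F" for F
  proof (rule ccontr)
    assume "\<not> ?thesis"
    then obtain T where T: "T \<subseteq> F" "card T = 3"
      using obtain_subset_with_card_n [of 3 F] by auto
    have "F \<subseteq> W" using F by (simp add: dissociation_set_def)
    then show False
      using no3 [of T] dissociation_set_subset [OF fin F T(1) _ fin] T by auto
  qed
  show ?thesis
  proof (intro equalityI subsetI)
    fix F assume F: "F \<in> mds E W"
    have "\<not> card F < 2"
    proof
      assume "card F < 2"
      then obtain F' where F': "F \<subseteq> F'" "F' \<subseteq> W" "card F' = 2"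
        using exists_subset_between [of F 2 W] mdsD(1) [OF F] fin two by auto
      then have "F' = F" using mdsD(3) [OF F pair] by blast
      then show False using F' \<open>card F < 2\<close> by simp
    qed
    then show "F \<in> {F. F \<subseteq> W \<and> card F = 2}"
      using small [OF mdsD(2) [OF F]] mdsD(1) [OF F] by auto
  next
    fix F assume "F \<in> {F. F \<subseteq> W \<and> card F = 2}"
    then have F: "F \<subseteq> W" "card F = 2" by auto
    show "F \<in> mds E W"
    proof (rule mdsI [OF pair [OF F]])
      fix F' assume F': "dissociation_set W E F'" "F \<subseteq> F'"
      have "finite F'" using F'(1) fin by (auto simp: dissociation_set_def intro: finite_subset)
      then show "F' = F"
        using card_seteq [of F' F] F' small [OF F'(1)] F by simp
    qed
  qed
qed

text \<open>Without a dissociation triple the maximal sets are the six pairs. If \<open>T\<close> is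
  one, then \<open>T\<close> is the only possible maximal set avoiding the fourth vertex
  \<open>w\<close>, and at most four contain \<open>w\<close>. So the value six rules out
  dissociation triples, which is what the equality analysis on five vertices uses.\<close>

lemma phi_four:
  assumes C: "card C = 4"
  shows "phi C E \<le> 6"
    and "phi C E = 6 \<Longrightarrow> T \<subseteq> C \<Longrightarrow> card T = 3 \<Longrightarrow> \<not> dissociation_set C E T"
proof -
  have fin: "finite C" using C by (simp add: card_ge_0_finite)
  have few: "phi C E \<le> 5" if T: "T \<subseteq> C" "card T = 3" "dissociation_set C E T" for T
  proof -
    obtain x y z where xyz: "T = {x, y, z}" using T(2) by (auto simp: card_3_iff)
    have "card (C - T) = 1" using T C fin by (simp add: card_Diff_subset finite_subset)
    then obtain w where w: "C - T = {w}" by (rule card_1_singletonE)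
    then have Ceq: "C = {w, x, y, z}" using T(1) xyz by auto
    \<comment> \<open>Three two-element chains cover the sets containing \<open>w\<close>, and each contains at most one maximal set.\<close>
    define P where "P A B = {F \<in> mds E C. F = A \<or> F = B}" for A B
    have P: "card (P A B) \<le> 1" if "A \<subseteq> B" for A B
      unfolding One_nat_def
    proof (rule card_le_Suc0_iff_eq [THEN iffD2])
      show "finite (P A B)" by (simp add: P_def)
      show "\<forall>F\<in>P A B. \<forall>F'\<in>P A B. F = F'"
        using that mds_antichain [of _ E C] by (auto simp: P_def)
    qed
    have sub: "mds E C \<subseteq> {T, C} \<union> P {w, x} {w, x, y} \<union> P {w, y} {w, y, z} \<union> P {w, z} {w, x, z}"
    proof
      fix F assume F: "F \<in> mds E C"
      show "F \<in> {T, C} \<union> P {w, x} {w, x, y} \<union> P {w, y} {w, y, z} \<union> P {w, z} {w, x, z}"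
      proof (cases "w \<in> F")
        case False
        then have "F \<subseteq> T" using mdsD(1) [OF F] w by auto
        then show ?thesis using mdsD(3) [OF F T(3)] by simp
      next
        case True
        have "F \<noteq> {w}"
        proof
          assume "F = {w}"
          moreover have "dissociation_set C E {w, x}"
            unfolding dissociation_set_iff [OF fin] using Ceq by auto
          ultimately have "{w, x} = {w}" using mdsD(3) [OF F] by blast
          then show False using w xyz by auto
        qed
        moreover define f where "f p q r =
          {w} \<union> (if p then {x} else {}) \<union> (if q then {y} else {}) \<union> (if r then {z} else {})" for p q r
        have "F = f (x \<in> F) (y \<in> F) (z \<in> F)"
          using True mdsD(1) [OF F] unfolding f_def Ceq by (auto split: if_splits)
        moreover have "f p q r \<in> {{w}, {w, x}, {w, y}, {w, z}, {w, x, y}, {w, y, z}, {w, x, z}, {w, x, y, z}}" for p q r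
          by (cases p; cases q; cases r) (simp_all add: f_def insert_commute)
        ultimately have "F \<in> {{w, x}, {w, y}, {w, z}, {w, x, y}, {w, y, z}, {w, x, z}, C}"
          unfolding Ceq by (metis insert_iff)
        then show ?thesis using F unfolding P_def by (elim insertE emptyE) simp_all
      qed
    qed
    have "card (mds E C) \<le> card ({T, C} \<union> P {w, x} {w, x, y} \<union> P {w, y} {w, y, z} \<union> P {w, z} {w, x, z})"
      by (rule card_mono [OF _ sub]) (simp add: P_def)
    also have "\<dots> \<le> card {T, C} + card (P {w, x} {w, x, y}) + card (P {w, y} {w, y, z}) + card (P {w, z} {w, x, z})"
      by (meson card_Un_le add_mono le_refl le_trans)
    also have "\<dots> \<le> 2 + 1 + 1 + 1"
      by (intro add_mono P) (auto simp: card_insert_if)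
    finally show ?thesis by (simp add: phi_mds)
  qed
  show "phi C E \<le> 6"
  proof (cases "\<exists>T. T \<subseteq> C \<and> card T = 3 \<and> dissociation_set C E T")
    case True
    then obtain T where "T \<subseteq> C" "card T = 3" "dissociation_set C E T" by (elim exE conjE)
    from few [OF this] show ?thesis by simp
  next
    case False
    then have "mds E C = {F. F \<subseteq> C \<and> card F = 2}"
      using C by (intro mds_eq_pairs fin) (simp, blast)
    then show ?thesis
      using n_subsets [OF fin, of 2] C by (simp add: phi_mds choose_two)
  qed
  show "phi C E = 6 \<Longrightarrow> T \<subseteq> C \<Longrightarrow> card T = 3 \<Longrightarrow> \<not> dissociation_set C E T"
    using few [of T] by auto
qed

text \<open>A dissociation set containing the universal vertex \<open>v\<close> has at most one
  other vertex, which gives at most four maximal sets; those avoiding \<open>v\<close> are bounded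
  by the six of the remaining four vertices. Equality excludes dissociation triples there, so no two
  missing edges meet.\<close>

lemma phi_five:
  assumes C: "card C = 5" and v: "v \<in> C" and adj: "\<And>u. u \<in> C \<Longrightarrow> u \<noteq> v \<Longrightarrow> {u, v} \<in> E"
  shows "phi C E \<le> 10" and "phi C E = 10 \<Longrightarrow> K5_minus_matching E C"
proof -
  have fin: "finite C" using C by (simp add: card_ge_0_finite)
  have D: "card (C - {v}) = 4" using C v fin by simp
  have "{F \<in> mds E C. v \<in> F} \<subseteq> (\<lambda>u. {u, v}) ` (C - {v})"
  proof clarify
    fix F assume F: "F \<in> mds E C" "v \<in> F"
    have "\<exists>u\<in>F. u \<noteq> v"
    proof (rule ccontr)
      assume "\<not> ?thesis"
      then have "F = {v}" using F(2) by blast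
      have "C - {v} \<noteq> {}" using D by (metis card.empty zero_neq_numeral)
      then obtain u where u: "u \<in> C - {v}" by blast
      have "dissociation_set C E {u, v}"
        using u v by (auto simp: dissociation_set_iff [OF fin])
      then show False using mdsD(3) [OF F(1), of "{u, v}"] \<open>F = {v}\<close> u by auto
    qed
    then obtain u where u: "u \<in> F" "u \<noteq> v" by blast
    have FC: "F \<subseteq> C" by (rule mdsD(1) [OF F(1)])
    have "x = u" if "x \<in> F" "x \<noteq> v" for x
      using mdsD(2) [OF F(1)] adj [of x] adj [of u] that u F(2) FC
      unfolding dissociation_set_iff [OF fin] by blast
    then have "F = {u, v}" using u F(2) by blast
    then show "F \<in> (\<lambda>u. {u, v}) ` (C - {v})" using u FC by blast
  qed
  then have "card {F \<in> mds E C. v \<in> F} \<le> card ((\<lambda>u. {u, v}) ` (C - {v}))"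
    using fin by (intro card_mono) auto
  also have "\<dots> \<le> 4" using D card_image_le [of "C - {v}" "\<lambda>u. {u, v}"] fin by simp
  finally have "card {F \<in> mds E C. v \<in> F} \<le> 4" .
  moreover have "phi C E = card {F \<in> mds E C. v \<in> F} + card {F \<in> mds E C. v \<notin> F}"
    unfolding phi_mds using finite_mds [OF fin, of E]
    by (subst card_Un_disjoint [symmetric]) (auto intro: arg_cong [of _ _ card])
  ultimately have le: "phi C E \<le> 4 + phi (C - {v}) E"
    using card_not_mem_mds_le [OF fin v, of E] by linarith
  then show "phi C E \<le> 10" using phi_four(1) [OF D] by linarith
  assume "phi C E = 10"
  then have six: "phi (C - {v}) E = 6" using le phi_four(1) [OF D] by linarith
  define M where "M = {e. e \<subseteq> C \<and> card e = 2} - E"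
  have M2: "e \<in> M \<Longrightarrow> \<exists>x y. e = {x, y} \<and> x \<noteq> y \<and> x \<in> C - {v} \<and> y \<in> C - {v}" for e
  proof -
    assume "e \<in> M"
    then have e: "e \<subseteq> C" "card e = 2" "e \<notin> E" by (auto simp: M_def)
    then obtain x y where xy: "e = {x, y}" "x \<noteq> y" by (auto simp: card_2_iff)
    have "x \<noteq> v" using adj [of y] xy e by (auto simp: insert_commute)
    moreover have "y \<noteq> v" using adj [of x] xy e by auto
    ultimately show ?thesis using xy e by auto
  qed
  have "disjoint M"
  proof (rule disjointI, rule ccontr)
    fix e e' assume e: "e \<in> M" "e' \<in> M" "e \<noteq> e'" "e \<inter> e' \<noteq> {}"
    then obtain x where x: "x \<in> e" "x \<in> e'" by blast
    obtain y where y: "e = {x, y}" "x \<noteq> y" "x \<in> C - {v}" "y \<in> C - {v}"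
      using M2 [OF e(1)] x(1) by (metis insert_commute insert_iff singletonD)
    obtain z where z: "e' = {x, z}" "x \<noteq> z" "z \<in> C - {v}"
      using M2 [OF e(2)] x(2) by (metis insert_commute insert_iff singletonD)
    have no: "{x, y} \<notin> E" "{x, z} \<notin> E" "{y, x} \<notin> E" "{z, x} \<notin> E"
      using e y z by (auto simp: M_def insert_commute)
    have "y \<noteq> z" using e y z by auto
    \<comment> \<open>With two edges missing at \<open>x\<close>, only the edge \<open>yz\<close>
      can remain among the three vertices.\<close>
    have "dissociation_set (C - {v}) E {x, y, z}"
      using y z fin no by (auto simp: dissociation_set_iff)
    then show False
      using phi_four(2) [OF D six, of "{x, y, z}"] y z \<open>y \<noteq> z\<close> by auto
  qed
  moreover have "card M \<le> 2"
  proof -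
    have "card (\<Union>M) = (\<Sum>e\<in>M. card e)"
      using \<open>disjoint M\<close> by (intro card_Union_disjoint) (auto simp: M_def card_2_iff)
    also have "\<dots> = (\<Sum>e\<in>M. 2)" by (rule sum.cong) (auto simp: M_def)
    finally have "card (\<Union>M) = 2 * card M" by simp
    moreover have "card (\<Union>M) \<le> card C" using fin by (intro card_mono) (auto simp: M_def)
    ultimately show ?thesis using C by linarith
  qed
  moreover have "{e \<in> E. e \<subseteq> C} = {e. e \<subseteq> C \<and> card e = 2} - M"
    using edgeD by (auto simp: M_def card_2_iff)
  ultimately show "K5_minus_matching E C"
    using C unfolding K5_minus_matching_def by (intro conjI exI [of _ M]) (auto simp: M_def)
qed

text \<open>A matching contains at most one of the three edges on a triple, and the two remaining
  edges share a vertex. Hence there are no dissociation triples, and all ten pairs are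
  maximal.\<close>

lemma phi_K5_minus_matching:
  assumes "K5_minus_matching E X"
  shows "phi X E = 10"
proof -
  obtain M where X: "card X = 5" and M: "disjoint M"
    and EX: "{e \<in> E. e \<subseteq> X} = {e. e \<subseteq> X \<and> card e = 2} - M"
    using assms by (auto simp: K5_minus_matching_def)
  have fin: "finite X" using X by (simp add: card_ge_0_finite)
  have edge: "{x, y} \<in> E \<longleftrightarrow> {x, y} \<notin> M" if "x \<in> X" "y \<in> X" "x \<noteq> y" for x y
    using that EX by (auto simp: set_eq_iff [of "{e \<in> E. e \<subseteq> X}"] dest!: spec [of _ "{x, y}"])
  have M': "\<not> ({x, y} \<in> M \<and> {x, z} \<in> M)" if "y \<noteq> z" for x y z
    using disjointD [OF M, of "{x, y}" "{x, z}"] that by (auto simp: doubleton_eq_iff)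
  have "mds E X = {F. F \<subseteq> X \<and> card F = 2}"
  proof (rule mds_eq_pairs [OF fin])
    fix T assume T: "T \<subseteq> X" "card T = 3"
    then obtain x y z where xyz: "T = {x, y, z}" "x \<noteq> y" "y \<noteq> z" "x \<noteq> z"
      by (auto simp: card_3_iff)
    have in_X: "x \<in> X" "y \<in> X" "z \<in> X" using T xyz by auto
    show "\<not> dissociation_set X E T"
    proof
      assume "dissociation_set X E T"
      then have d: "\<And>v x y. v \<in> T \<Longrightarrow> x \<in> T \<Longrightarrow> y \<in> T \<Longrightarrow> {x, v} \<in> E \<Longrightarrow> {y, v} \<in> E \<Longrightarrow> x = y"
        unfolding dissociation_set_iff [OF fin] by blast
      have "{y, x} \<notin> E \<or> {z, x} \<notin> E" "{x, y} \<notin> E \<or> {z, y} \<notin> E" "{x, z} \<notin> E \<or> {y, z} \<notin> E"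
        using d [of x y z] d [of y x z] d [of z x y] xyz by auto
      then show False
        using edge [of x y] edge [of y x] edge [of x z] edge [of z x] edge [of y z] edge [of z y]
          in_X xyz M' [of y z x] M' [of x z y] M' [of x y z]
        by (auto simp: insert_commute)
    qed
  qed (simp add: X)
  then show ?thesis
    using n_subsets [OF fin, of 2] X by (simp add: phi_mds choose_two)
qed

end

context branching
begin

section \<open>Graphs of maximum degree three\<close>

text \<open>Using a list lets the cost of each class be written out as a summand, with no need to
  know that the classes are distinct.\<close>

lemma phi_cover:
  assumes "M \<subseteq> \<Union>(set Xs)" and "\<And>X. X \<in> set Xs \<Longrightarrow> finite X"
  shows "real (phi W E) \<le> (\<Sum>X\<leftarrow>Xs. real (card X))"
proof -
  have "card (\<Union>(set Ys)) \<le> (\<Sum>X\<leftarrow>Ys. card X)" for Ys :: "'a set set list"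
  proof (induction Ys)
    case (Cons Y Ys)
    then show ?case using card_Un_le [of Y "\<Union>(set Ys)"] by simp
  qed simp
  then have "card M \<le> (\<Sum>X\<leftarrow>Xs. card X)"
    using card_mono [OF _ assms(1)] assms(2) by (meson finite_Union finite_set le_trans)
  moreover have "real (\<Sum>X\<leftarrow>Xs. card X) = (\<Sum>X\<leftarrow>Xs. real (card X))"
    by (induction Xs) auto
  ultimately show ?thesis by (metis phi_mds of_nat_le_iff)
qed

lemma card_UN_bound:
  assumes "finite I" "card I = n" "\<And>i. i \<in> I \<Longrightarrow> real (card (B i)) \<le> w"
  shows "real (card (\<Union>i\<in>I. B i)) \<le> real n * w"
proof -
  have "real (card (\<Union>i\<in>I. B i)) \<le> real (\<Sum>i\<in>I. card (B i))"
    using card_UN_le [OF assms(1)] of_nat_le_iff by blast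
  also have "\<dots> \<le> (\<Sum>i\<in>I. w)" unfolding of_nat_sum by (intro sum_mono assms(3))
  finally show ?thesis by (simp add: assms(2))
qed

lemma duo_out_le:
  assumes "v \<in> W" "u \<in> N v" "\<not> N u \<subseteq> cl v"
  shows "real (card (duo u v)) \<le> wt (card (N v) + 2)"
proof (rule duo_le [OF assms(1,2)])
  have "card (cl v) < card (cl u \<union> cl v)" using assms(3) by (intro psubset_card_mono) auto
  then show "card (N v) + 2 \<le> card (cl u \<union> cl v)" by simp
qed simp

lemma phi_component:
  assumes "C \<subseteq> W" "\<And>u. u \<in> C \<Longrightarrow> N u \<subseteq> C"
  shows "phi W E = phi C E * phi (W - C) E"
proof -
  have "phi (C \<union> (W - C)) E = phi C E * phi (W - C) E"
  proof (rule phi_Un)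
    show "finite C" "finite (W - C)" using fin assms(1) by (auto intro: finite_subset)
    show "{x, y} \<notin> E" if "x \<in> C" "y \<in> W - C" for x y
      using assms(2) [OF that(1)] that(2) by (auto simp: nbh_def insert_commute)
  qed auto
  moreover have "C \<union> (W - C) = W" using assms(1) by blast
  ultimately show ?thesis by simp
qed

text \<open>Numerically 6 * 0.1585 = 0.951.\<close>

lemma phi_less_closed_four:
  assumes "C \<subseteq> W" "card C = 4" "\<And>u. u \<in> C \<Longrightarrow> N u \<subseteq> C"
  shows "real (phi W E) < wt 0"
proof -
  have "phi W E = phi C E * phi (W - C) E" by (rule phi_component [OF assms(1,3)])
  also have "\<dots> \<le> 6 * phi (W - C) E"
    using phi_four(1) [OF assms(2)] by (rule mult_right_mono) simp
  finally have "real (phi W E) \<le> 6 * real (phi (W - C) E)"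
    by (metis of_nat_le_iff of_nat_mult of_nat_numeral)
  moreover have "real (phi (W - C) E) \<le> wt 4"
    using assms(1,2) by (intro phi_minus_le) auto
  ultimately show ?thesis using wt_bounds(4) wt_pos [of 0] by linarith
qed

text \<open>Once \<open>v\<close> is deleted, \<open>y\<close> is pendant, so the pendant estimate
  applies in the same locale instantiated at \<open>W - {v}\<close>, whose weight at 0 is
  \<open>wt 1\<close>.\<close>

lemma phi_del_pendant:
  assumes v: "v \<in> W" and y: "y \<in> N v" "card (N y) = 2"
  shows "real (phi (W - {v}) E) \<le> 901 / 1000 * wt 1"
proof -
  interpret del: branching E "W - {v}"
    by unfold_locales (use fin smaller in auto)
  have "nbh E (W - {v}) y = N y - {v}" by (auto simp: nbh_def)
  then have "card (nbh E (W - {v}) y) = 1"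
    using y(2) N_sym [OF y(1) v] by simp
  moreover have "y \<in> W - {v}" using y(1) N_sub not_in_N by blast
  ultimately have "real (phi (W - {v}) E) \<le> 901 / 1000 * del.wt 0"
    by (intro del.phi_pendant)
  moreover have "del.wt 0 = wt 1"
  proof -
    have "card W = Suc (card (W - {v}))" using card_Suc_Diff1 [OF fin v] by simp
    then show ?thesis using root5_pos by (simp add: del.wt_def wt_def)
  qed
  ultimately show ?thesis by simp
qed

text \<open>The neighbour inside \<open>cl v\<close> makes \<open>solo v\<close> empty. Two leaving
  neighbours give 0.631 + 0.1585 + 0.2 < 0.99. One leaving neighbour gives 0.631 + 0.317 + 0.1 > 1;
  there a neighbour of degree two is found, and the deletion term drops by the factor 0.901. With
  none, \<open>cl v\<close> is a component on four vertices.\<close>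

lemma phi_less_degree_three:
  assumes v: "v \<in> W" "card (N v) = 3"
    and deg: "\<And>u. u \<in> W \<Longrightarrow> 2 \<le> card (N u) \<and> card (N u) \<le> 3"
    and inside: "\<exists>u\<in>N v. N u \<subseteq> cl v"
  shows "real (phi W E) < wt 0"
proof -
  define Q where "Q = {u \<in> N v. \<not> N u \<subseteq> cl v}"
  define k where "k = card Q"
  have ne: "N v \<noteq> {}" using v(2) by auto
  have "Q \<subset> N v" using inside by (auto simp: Q_def)
  then have "k < 3" using psubset_card_mono [of "N v" Q] v(2) by (simp add: k_def)
  note branch = phi_branch(1) [OF v(1) ne v(2) k_def [unfolded Q_def, symmetric]]
  note wb = wt_bounds wt_pos [of 0]
  consider "k = 0" | "k = 1" | "k = 2" using \<open>k < 3\<close> by linarith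
  then show ?thesis
  proof cases
    case 1
    then have "Q = {}" unfolding k_def by (simp add: Q_def)
    then have "N u \<subseteq> cl v" if "u \<in> cl v" for u using that by (auto simp: Q_def)
    then show ?thesis
      using v N_sub [of v] by (intro phi_less_closed_four [of "cl v"]) auto
  next
    case 2
    then obtain a where Q: "Q = {a}" unfolding k_def by (rule card_1_singletonE)
    then have a: "a \<in> N v" "\<not> N a \<subseteq> cl v" by (auto simp: Q_def)
    then obtain x where x: "x \<in> N a" "x \<notin> cl v" by blast
    have "card (N v - {a}) = 2" using a(1) v(2) by simp
    then obtain b c where bc: "N v - {a} = {b, c}" "b \<noteq> c" by (auto simp: card_2_iff)
    then have Nv: "N v = {a, b, c}" "a \<noteq> b" "a \<noteq> c" using a(1) by auto
    have W: "a \<in> W" "b \<in> W" "c \<in> W" using Nv N_sub [of v] by auto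
    have "v \<in> N a" using N_sym [OF a(1) v(1)] .
    have na: "\<not> (b \<in> N a \<and> c \<in> N a)"
    proof
      assume "b \<in> N a \<and> c \<in> N a"
      then have "{v, x, b, c} \<subseteq> N a" using x \<open>v \<in> N a\<close> by simp
      moreover have "v \<notin> {x, a, b, c}" "x \<notin> {v, a, b, c}" using x(2) not_in_N [of v] unfolding Nv by auto
      then have "card {v, x, b, c} = 4" using bc(2) by simp
      ultimately have "4 \<le> card (N a)" using card_mono [OF finN] by metis
      then show False using deg [OF W(1)] by simp
    qed
    have "N u \<subseteq> cl v" if "u \<in> N v" "u \<noteq> a" for u
      using Q that unfolding Q_def by blast
    then have sub: "N b \<subseteq> {v, a, b, c}" "N c \<subseteq> {v, a, b, c}"
      using Nv bc(2) unfolding Nv(1) by auto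
    have two: "\<not> N u \<subseteq> {v}" if "u \<in> W" for u
      using deg [OF that] card_mono [of "{v}" "N u"] by auto
    have "b \<in> N a \<or> c \<in> N b"
      using two [OF W(2)] sub(1) Nv not_in_N [of b] N_sym [of a b] W by blast
    moreover have "c \<in> N a \<or> b \<in> N c"
      using two [OF W(3)] sub(2) Nv not_in_N [of c] N_sym [of a c] W by blast
    ultimately have cb: "c \<in> N b" "b \<in> N c" using na N_sym W by blast+
    \<comment> \<open>Since \<open>a\<close> is adjacent to at most one of \<open>b\<close> and
      \<open>c\<close>, the other has only \<open>v\<close> and its mate in the edge
      \<open>bc\<close> as neighbours.\<close>
    have "\<exists>y\<in>N v. card (N y) = 2"
    proof (cases "b \<in> N a")
      case True
      then have "N c \<subseteq> {v, b}" using na sub(2) Nv not_in_N [of c] N_sym [of a c] W by blast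
      then have "card (N c) \<le> 2" using card_mono [of "{v, b}" "N c"] by (simp add: card_insert_if split: if_splits)
      then show ?thesis using deg [OF W(3)] Nv by force
    next
      case False
      then have "N b \<subseteq> {v, c}" using sub(1) Nv not_in_N [of b] N_sym [of a b] W by blast
      then have "card (N b) \<le> 2" using card_mono [of "{v, c}" "N b"] by (simp add: card_insert_if split: if_splits)
      then show ?thesis using deg [OF W(2)] Nv by force
    qed
    then have "real (phi (W - {v}) E) \<le> 901 / 1000 * wt 1"
      using phi_del_pendant [OF v(1)] by blast
    then show ?thesis using branch 2 wb by simp
  next
    case 3
    then show ?thesis using branch phi_del_le [OF v(1)] wb by simp
  qed
qed

lemma solo_Int_le:
  assumes "a \<in> W" "b \<in> W" "0 < r" "r \<le> card (cl a \<union> cl b)"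
  shows "real (card (solo a \<inter> solo b)) \<le> wt r"
proof (rule trace_le [of "{a, b}" "cl a \<union> cl b"])
  show "cl a \<union> cl b \<subseteq> W" using N_sub assms(1,2) by blast
  show "solo a \<inter> solo b \<subseteq> {F \<in> M. F \<inter> (cl a \<union> cl b) = {a, b}}"
    by (auto simp: solo_def)
qed (use assms in auto)

text \<open>Bounding the sets without \<open>v\<close> by deletion is too expensive here, so they
  are sorted by what blocks \<open>v\<close>: a neighbour with a partner, or both neighbours
  standing alone. The pairs through \<open>v\<close> fall into the same families. The generic sum is
  0.2512 + 2 * 0.317 + 0.1 = 0.9852.\<close>

lemma phi_less_degree_two:
  assumes v: "v \<in> W" "card (N v) = 2"
    and deg: "\<And>u. u \<in> W \<Longrightarrow> card (N u) = 2 \<or> card (N u) = 3"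
    and out3: "\<And>u w. u \<in> W \<Longrightarrow> card (N u) = 3 \<Longrightarrow> w \<in> N u \<Longrightarrow> \<not> N w \<subseteq> cl u"
  shows "real (phi W E) < wt 0"
proof -
  note wb = wt_bounds wt_pos [of 0]
  obtain a b where Nv: "N v = {a, b}" "a \<noteq> b" using v(2) by (auto simp: card_2_iff)
  have W: "a \<in> W" "b \<in> W" using Nv N_sub [of v] by auto
  have va: "v \<in> N a" and vb: "v \<in> N b" using N_sym [OF _ v(1)] Nv by auto
  have "v \<noteq> a" "v \<noteq> b" using Nv not_in_N [of v] by auto
  show ?thesis
  proof (cases "b \<in> N a")
    case True
    then have ab: "a \<in> N b" using N_sym W by blast
    \<comment> \<open>Degree three at \<open>a\<close> would contradict \<open>out3\<close>, because
      \<open>N v\<close> lies in \<open>cl a\<close>. So \<open>v\<close>, \<open>a\<close>,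
      \<open>b\<close> form a triangle component, costing 3 * 0.2512.\<close>
    have "card (N a) = 2" using deg [OF W(1)] out3 [OF W(1) _ va] Nv True by auto
    then have Na: "N a = {v, b}"
      using card_seteq [of "N a" "{v, b}"] va True \<open>v \<noteq> b\<close> by auto
    have "card (N b) = 2" using deg [OF W(2)] out3 [OF W(2) _ vb] Nv ab by auto
    then have Nb: "N b = {v, a}"
      using card_seteq [of "N b" "{v, a}"] vb ab \<open>v \<noteq> a\<close> by auto
    have "M \<subseteq> \<Union>(set [duo a v, duo b v, duo a b])"
    proof
      fix F assume F: "F \<in> M"
      show "F \<in> \<Union>(set [duo a v, duo b v, duo a b])"
      proof (cases "v \<in> F")
        case True
        have "F \<notin> solo v"
          using solo_outside [OF _ v(1), of F a] Nv Na by auto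
        then show ?thesis using mem_cases [OF F True] Nv by auto
      next
        case False
        have "F \<notin> solo a \<inter> solo b"
        proof
          assume "F \<in> solo a \<inter> solo b"
          then have "F \<inter> cl a = {a}" "b \<in> F" by (auto simp: solo_def)
          then show False using Nv(2) \<open>b \<in> N a\<close> by auto
        qed
        then show ?thesis
          using not_mem_cases [OF F v(1) False] Nv Na Nb by (auto simp: duo_comm)
      qed
    qed
    then have le: "real (phi W E) \<le> real (card (duo a v)) + real (card (duo b v)) + real (card (duo a b))"
      by (rule phi_cover [THEN order_trans]) auto
    have d3: "real (card (duo x y)) \<le> wt 3" if "x \<in> N y" "y \<in> {v, a, b}" for x y
    proof (rule duo_le)
      have "3 \<le> card (cl y)" using that Nv Na Nb \<open>v \<noteq> a\<close> \<open>v \<noteq> b\<close> by auto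
      also have "\<dots> \<le> card (cl x \<union> cl y)" by (intro card_mono) auto
      finally show "3 \<le> card (cl x \<union> cl y)" .
    qed (use that v W in auto)
    have "real (card (duo a v)) \<le> wt 3" "real (card (duo b v)) \<le> wt 3" "real (card (duo a b)) \<le> wt 3"
      using Nv ab by (auto intro: d3)
    then show ?thesis using le wb by linarith
  next
    case nab: False
    then have nba: "a \<notin> N b" using N_sym W by blast
    \<comment> \<open>The hypothesis \<open>out3\<close> covers only degree three. If
      \<open>x\<close> has degree two, its other neighbour \<open>w\<close> is not adjacent to
      \<open>v\<close>, so staying inside \<open>cl x\<close> would make \<open>w\<close> have
      degree at most one.\<close>
    have out: "\<not> N w \<subseteq> cl x" if x: "x \<in> {a, b}" and w: "w \<in> N x" for x w
    proof (cases "w = v")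
      case True
      then show ?thesis using x Nv nab nba by auto
    next
      case wv: False
      have xW: "x \<in> W" using x W by auto
      show ?thesis
      proof (cases "card (N x) = 3")
        case True
        then show ?thesis using out3 [OF xW _ w] by simp
      next
        case False
        then have "card (N x) = 2" using deg [OF xW] by simp
        moreover have "v \<in> N x" using x va vb by auto
        ultimately have Nx: "N x = {v, w}"
          using card_seteq [of "N x" "{v, w}"] w wv by auto
        show ?thesis
        proof
          assume "N w \<subseteq> cl x"
          moreover have "w \<in> W" using w N_sub by blast
          moreover have "v \<notin> N w"
          proof
            assume "v \<in> N w"
            then have "w \<in> N v" using N_sym \<open>w \<in> W\<close> by blast
            then show False using w x Nv nab nba not_in_N by auto
          qed
          ultimately have "N w \<subseteq> {x}" using Nx not_in_N [of w] by auto
          then have "card (N w) \<le> 1" using card_mono [of "{x}" "N w"] by simp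
          then show False using deg [OF \<open>w \<in> W\<close>] by auto
        qed
      qed
    qed
    \<comment> \<open>Degree two costs 2 * 0.1585, degree three costs 3 * 0.1.\<close>
    have side: "real (card (\<Union>w\<in>N x. duo w x)) \<le> 317 / 1000 * wt 0" if x: "x \<in> {a, b}" for x
    proof -
      have xW: "x \<in> W" using x W by auto
      have "real (card (\<Union>w\<in>N x. duo w x)) \<le> real (card (N x)) * wt (card (N x) + 2)"
        by (intro card_UN_bound duo_out_le xW out x) auto
      then show ?thesis using deg [OF xW] wb by (elim disjE) auto
    qed
    let ?L = "[solo v, \<Union>w\<in>N a. duo w a, \<Union>w\<in>N b. duo w b, solo a \<inter> solo b]"
    have "M \<subseteq> \<Union>(set ?L)"
    proof
      fix F assume F: "F \<in> M"
      show "F \<in> \<Union>(set ?L)"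
      proof (cases "v \<in> F")
        case True
        have "F \<in> duo v x" if "F \<in> duo x v" for x using that by (simp add: duo_comm)
        then show ?thesis using mem_cases [OF F True] Nv va vb by auto
      next
        case False
        from not_mem_cases [OF F v(1) False] show ?thesis
        proof
          assume "\<exists>u\<in>N v. \<exists>w\<in>N u - {v}. F \<in> duo u w"
          then obtain u w where uw: "u \<in> N v" "w \<in> N u" "F \<in> duo u w" by blast
          then have "F \<in> duo w u" by (simp only: duo_comm)
          then show ?thesis using uw Nv by auto
        qed (use Nv in auto)
      qed
    qed
    then have le: "real (phi W E) \<le> real (card (solo v)) + real (card (\<Union>w\<in>N a. duo w a))
        + real (card (\<Union>w\<in>N b. duo w b)) + real (card (solo a \<inter> solo b))"
      by (rule phi_cover [THEN order_trans]) auto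
    have sv: "real (card (solo v)) \<le> wt 3" using solo_le [OF v(1), of 3] v(2) by simp
    show ?thesis
    proof (cases "5 \<le> card (cl a \<union> cl b)")
      case True
      then have "real (card (solo a \<inter> solo b)) \<le> wt 5" by (intro solo_Int_le W) auto
      then show ?thesis using le sv side [of a] side [of b] wb by auto
    next
      case False
      \<comment> \<open>With fewer than five vertices in the union, \<open>a\<close> and
        \<open>b\<close> have the same neighbours \<open>v\<close> and \<open>x\<close>: a
        four-cycle, which is a component unless \<open>x\<close> has a third neighbour.\<close>
      have ab: "card {a, b, v} = 3" using Nv \<open>v \<noteq> a\<close> \<open>v \<noteq> b\<close> by auto
      have "card (N a - {v}) \<noteq> 0" using deg [OF W(1)] va by auto
      then obtain x where x: "x \<in> N a" "x \<noteq> v" by (metis card.empty ex_in_conv DiffE singletonI)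
      have "card (N b - {v}) \<noteq> 0" using deg [OF W(2)] vb by auto
      then obtain x' where x': "x' \<in> N b" "x' \<noteq> v" by (metis card.empty ex_in_conv DiffE singletonI)
      have xn: "x \<notin> {a, b, v}" using x nab not_in_N by auto
      have c4: "card {x, a, b, v} = 4" using ab xn by (subst card_insert_disjoint) auto
      have S: "cl a \<union> cl b = {x, a, b, v}"
      proof (rule sym, rule card_seteq)
        show "{x, a, b, v} \<subseteq> cl a \<union> cl b" using x va by auto
        show "card (cl a \<union> cl b) \<le> card {x, a, b, v}"
          using False unfolding c4 by linarith
      qed simp
      have Na: "N a = {v, x}" using S va x nab not_in_N [of a] by blast
      have Nb: "N b = {v, x}"
      proof -
        have "x' \<in> {x, a, b, v}" using S x' by blast
        then have "x' = x" using x' nba not_in_N [of b] by auto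
        then show ?thesis using S vb x' nba not_in_N [of b] by blast
      qed
      have xW: "x \<in> W" using x N_sub by blast
      have Nx: "a \<in> N x" "b \<in> N x" using N_sym [OF _ W(1)] N_sym [OF _ W(2)] Na Nb by auto
      have vx: "v \<notin> N x" using N_sym [OF _ xW, of v] Nv xn by auto
      show ?thesis
      proof (cases "card (N x) = 2")
        case True
        then have "N x = {a, b}" using card_seteq [of "N x" "{a, b}"] Nx Nv(2) by auto
        then show ?thesis
          using Na Nb Nv v W xW xn \<open>v \<noteq> a\<close> \<open>v \<noteq> b\<close>
          by (intro phi_less_closed_four [of "{x, a, b, v}"] c4) auto
      next
        case False
        \<comment> \<open>The third neighbour of \<open>x\<close> raises the cost of pairs with
          \<open>x\<close> to five vertices, and the sum becomes 0.2512 + 2 * 0.2585 + 0.1585 <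
          0.93.\<close>
        then have x4: "card (cl x) = 4" using deg [OF xW] by simp
        have x5: "real (card (duo x y)) \<le> wt 5" if y: "y \<in> {a, b}" for y
        proof (rule duo_le)
          have "v \<in> cl y" "v \<notin> cl x" using y va vb vx xn by auto
          then have "cl x \<subset> cl x \<union> cl y" by blast
          then have "card (cl x) < card (cl x \<union> cl y)" by (intro psubset_card_mono) auto
          then show "5 \<le> card (cl x \<union> cl y)" using x4 by simp
        qed (use y W Na Nb in auto)
        have v4: "real (card (duo v y)) \<le> wt 4" if y: "y \<in> {a, b}" for y
        proof -
          have "y \<in> W" "v \<in> N y" "card (N y) = 2" using y W va vb Na Nb xn by auto
          then show ?thesis using duo_out_le [of y v] out [OF y] by simp
        qed
        have U: "real (card (\<Union>w\<in>N y. duo w y)) \<le> wt 4 + wt 5" if y: "y \<in> {a, b}" for y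
        proof -
          have "N y = {v, x}" using y Na Nb by auto
          then have "(\<Union>w\<in>N y. duo w y) = duo v y \<union> duo x y" by simp
          then have "card (\<Union>w\<in>N y. duo w y) \<le> card (duo v y) + card (duo x y)"
            by (simp add: card_Un_le)
          then show ?thesis using x5 [OF y] v4 [OF y] by linarith
        qed
        have "real (card (solo a \<inter> solo b)) \<le> wt 4"
          using S c4 by (intro solo_Int_le W) auto
        then show ?thesis using le sv U [of a] U [of b] wb by auto
      qed
    qed
  qed
qed

section \<open>Cubic graphs\<close>

lemma card_tri: "card {a, b, c} = 3 \<Longrightarrow> a \<noteq> b \<and> a \<noteq> c \<and> b \<noteq> c"
  by (auto simp: card_insert_if split: if_splits)

text \<open>The excluded vertex \<open>a\<close> has \<open>a'\<close> as its only neighbour outside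
  \<open>cl v\<close>, so \<open>a'\<close> is forced into \<open>F\<close>. Splitting by whether
  \<open>a'\<close> is alone or paired gives (1 + q) * \<open>wt (5 + q)\<close> with q =
  \<open>card Q\<close>: at most 0.1262 for q = 1 and 0.1195 for q = 2, against 0.1585 from
  \<open>solo_le\<close>.\<close>

lemma cubic_triangle_solo:
  assumes cubic: "\<And>x. x \<in> W \<Longrightarrow> card (N x) = 3" and v: "v \<in> W"
    and Nv: "N v = {a, b, c}" and Na: "N a = {v, b, a'}" and a': "a' \<notin> N v" "a' \<notin> N b"
  shows "real (card (solo v)) \<le> 1263 / 10000 * wt 0"
proof -
  have W: "a \<in> W" "b \<in> W" "c \<in> W" "a' \<in> W" using Nv Na N_sub by blast+
  have dist: "a \<noteq> b \<and> a \<noteq> c \<and> b \<noteq> c" "v \<noteq> b \<and> v \<noteq> a' \<and> b \<noteq> a'"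
    using cubic [OF v] cubic [OF W(1)] card_tri unfolding Nv Na by metis+
  have "v \<noteq> a" "v \<noteq> c" using Nv not_in_N [of v] by auto
  have "a \<in> N a'" using N_sym [of a' a] Na W by auto
  \<comment> \<open>The candidates for a partner of \<open>a'\<close>: both \<open>a\<close> and
    \<open>c\<close> lie in \<open>N v\<close> and are therefore outside \<open>F\<close>.\<close>
  define Q where "Q = N a' - {a, c}"
  define R where "R = cl v \<union> cl a'"
  have vb: "v \<notin> N a'" "b \<notin> N a'" using N_sym [of v a'] N_sym [of b a'] a' W v by auto
  have Q: "Q \<inter> cl v = {}" unfolding Q_def Nv using vb by auto
  have "card (cl v \<union> insert a' Q) = 5 + card Q"
  proof -
    have "a' \<notin> cl v \<union> Q" using a' dist by (auto simp: Q_def)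
    moreover have "card (cl v \<union> Q) = card (cl v) + card Q"
      using Q by (intro card_Un_disjoint) (auto simp: Q_def)
    moreover have "card (cl v) = 4" using cubic [OF v] by simp
    moreover have "finite (cl v \<union> Q)" by (simp add: Q_def)
    ultimately show ?thesis by simp
  qed
  moreover have "card (cl v \<union> insert a' Q) \<le> card R"
    by (intro card_mono) (auto simp: R_def Q_def)
  ultimately have R: "5 + card Q \<le> card R" by simp
  have RW: "R \<subseteq> W" unfolding R_def using N_sub v W by blast
  define G where "G = {F \<in> M. F \<inter> R = {v, a'}}"
  define H where "H t = {F \<in> M. F \<inter> (R \<union> cl t) = {v, a', t}}" for t
  have "solo v \<subseteq> G \<union> (\<Union>t\<in>Q. H t)"
  proof
    fix F assume F: "F \<in> solo v"
    then have FM: "F \<in> M" and Fv: "F \<inter> cl v = {v}" by (auto simp: solo_def)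
    have "N a - cl v = {a'}" using Na Nv a' dist by auto
    then have "a' \<in> F" using solo_outside [OF F v, of a] Nv by auto
    from mem_cases [OF FM this] show "F \<in> G \<union> (\<Union>t\<in>Q. H t)"
    proof
      assume "F \<in> solo a'"
      then have "F \<inter> R = {v, a'}" using Fv unfolding solo_def R_def by blast
      then show ?thesis using FM by (simp add: G_def)
    next
      assume "\<exists>t\<in>N a'. F \<in> duo t a'"
      then obtain t where t: "t \<in> N a'" "F \<inter> (cl t \<union> cl a') = {t, a'}" by (auto simp: duo_def)
      then have "t \<in> F" by blast
      have "t \<notin> {a, c}"
      proof
        assume "t \<in> {a, c}"
        then have "t \<in> F \<inter> cl v" using \<open>t \<in> F\<close> Nv by auto
        then show False using Fv \<open>t \<in> {a, c}\<close> \<open>v \<noteq> a\<close> \<open>v \<noteq> c\<close> by auto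
      qed
      then have "t \<in> Q" using t(1) by (simp add: Q_def)
      moreover have "F \<inter> (R \<union> cl t) = {v, a', t}" using Fv t(2) unfolding R_def by blast
      ultimately show ?thesis using FM by (auto simp: H_def)
    qed
  qed
  then have "card (solo v) \<le> card (G \<union> (\<Union>t\<in>Q. H t))"
    using finite_mds [OF fin, of E] by (intro card_mono) (auto simp: G_def H_def Q_def)
  then have "card (solo v) \<le> card G + card (\<Union>t\<in>Q. H t)"
    using card_Un_le le_trans by blast
  moreover have "real (card G) \<le> wt (5 + card Q)"
    by (rule trace_le [of "{v, a'}" R]) (use R RW in \<open>auto simp: R_def G_def\<close>)
  moreover have "real (card (\<Union>t\<in>Q. H t)) \<le> real (card Q) * wt (5 + card Q)"
  proof (rule card_UN_bound)
    fix t assume t: "t \<in> Q"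
    show "real (card (H t)) \<le> wt (5 + card Q)"
    proof (rule trace_le [of "{v, a', t}" "R \<union> cl t"])
      show "R \<union> cl t \<subseteq> W" using RW N_sub t unfolding Q_def by blast
      have "card R \<le> card (R \<union> cl t)" by (intro card_mono) (auto simp: R_def)
      then show "5 + card Q \<le> card (R \<union> cl t)" using R by simp
      show "{v, a', t} \<subseteq> R \<union> cl t" by (auto simp: R_def)
      show "N k \<subseteq> R \<union> cl t" if "k \<in> {v, a', t}" for k using that by (auto simp: R_def)
    qed (auto simp: H_def)
  qed (auto simp: Q_def)
  ultimately have le: "real (card (solo v)) \<le> wt (5 + card Q) + real (card Q) * wt (5 + card Q)"
    by linarith
  have "card Q = 1 \<or> card Q = 2"
  proof -
    have "card (N a' - {a}) = 2" using cubic [OF W(4)] \<open>a \<in> N a'\<close> by simp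
    moreover have "Q = N a' - {a} - {c}" by (auto simp: Q_def)
    ultimately show ?thesis by (cases "c \<in> N a' - {a}") auto
  qed
  then show ?thesis using le wt_bounds wt_pos [of 0] by (elim disjE) auto
qed

text \<open>With no triangle at \<open>v\<close>, each pair removes six vertices: 0.631 + 0.1585 + 3
  * 0.0631 < 0.98. On a triangle two of the pairs may remove only five, and deleting
  \<open>v\<close> would give about 1.02 even with the sharper bound on \<open>solo v\<close>.
  Sorting by how \<open>F\<close> meets the whole triangle gives 0.1262 + 3 * 0.1263 + 3 * 0.1 + 3 *
  0.0631 = 0.9944.\<close>

lemma phi_less_cubic:
  assumes cubic: "\<And>x. x \<in> W \<Longrightarrow> card (N x) = 3"
    and out: "\<And>x u. x \<in> W \<Longrightarrow> u \<in> N x \<Longrightarrow> \<not> N u \<subseteq> cl x"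
    and v: "v \<in> W"
  shows "real (phi W E) < wt 0"
proof (cases "\<exists>a\<in>N v. \<exists>b\<in>N v. b \<in> N a")
  case False
  have "(\<Sum>u\<in>N v. real (card (duo u v))) \<le> (\<Sum>u\<in>N v. wt 6)"
  proof (intro sum_mono duo_le v)
    fix u assume u: "u \<in> N v"
    have "v \<in> N u" using N_sym [OF u v] .
    have "N u \<inter> cl v = {v}" using False u \<open>v \<in> N u\<close> by blast
    then have "card (N u - cl v) = 2"
      using cubic [of u] u N_sub [of v] by (subst card_Diff_subset_Int) auto
    moreover have "card (cl v \<union> (N u - cl v)) = card (cl v) + card (N u - cl v)"
      by (intro card_Un_disjoint) auto
    moreover have "card (cl v) = 4" using cubic [OF v] by simp
    moreover have "card (cl v \<union> (N u - cl v)) \<le> card (cl u \<union> cl v)"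
      by (intro card_mono) auto
    ultimately show "6 \<le> card (cl u \<union> cl v)" by linarith
  qed auto
  also have "\<dots> = 3 * wt 6" using cubic [OF v] by simp
  finally have s: "(\<Sum>u\<in>N v. real (card (duo u v))) \<le> 3 * wt 6" .
  have "real (card (solo v)) \<le> wt 4" using solo_le [OF v, of 4] cubic [OF v] by simp
  then show ?thesis
    using s phi_split [OF v] card_not_mem_mds_le [OF fin v, of E] phi_del_le [OF v]
      wt_bounds wt_pos [of 0] by linarith
next
  case True
  then obtain a b where ab: "a \<in> N v" "b \<in> N v" "b \<in> N a" by blast
  have third: "\<exists>z. N x = {y, y', z} \<and> z \<notin> {x, y, y'}" if "x \<in> W" "y \<in> N x" "y' \<in> N x" "y \<noteq> y'" for x y y'
  proof -
    have "card (N x - {y, y'}) = 1"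
      using that cubic [of x] by (subst card_Diff_subset) auto
    then obtain z where "N x - {y, y'} = {z}" by (rule card_1_singletonE)
    then show ?thesis using that not_in_N [of x] by (intro exI [of _ z]) blast
  qed
  have W: "a \<in> W" "b \<in> W" using ab N_sub by blast+
  have sym: "v \<in> N a" "v \<in> N b" "a \<in> N b" using ab N_sym v W by blast+
  have "v \<noteq> a" "v \<noteq> b" "a \<noteq> b" using ab not_in_N by blast+
  obtain c where Nv: "N v = {a, b, c}" "c \<notin> {v, a, b}"
    using third [OF v ab(1,2)] \<open>a \<noteq> b\<close> by blast
  obtain a' where Na: "N a = {v, b, a'}" "a' \<notin> {a, v, b}"
    using third [OF W(1) sym(1) ab(3)] \<open>v \<noteq> b\<close> by blast
  obtain b' where Nb: "N b = {v, a, b'}" "b' \<notin> {b, v, a}"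
    using third [OF W(2) sym(2,3)] \<open>v \<noteq> a\<close> by blast
  \<comment> \<open>A common outer neighbour of two triangle vertices would enclose one
    neighbourhood in the closed neighbourhood of the other, against \<open>out\<close>.\<close>
  have "c \<noteq> a'" using out [OF v ab(1)] Nv Na by auto
  moreover have "c \<noteq> b'" using out [OF v ab(2)] Nv Nb by auto
  moreover have "a' \<noteq> b'" using out [OF W(1) ab(3)] Na Nb by auto
  ultimately have dist: "c \<noteq> a'" "c \<noteq> b'" "a' \<noteq> b'" by auto
  have inner: "real (card (duo x y)) \<le> wt 5" if "x \<in> N y" "y \<in> W" for x y
    using duo_out_le [OF that(2,1) out [OF that(2,1)]] cubic [OF that(2)] by simp
  have outer: "real (card (duo z x)) \<le> wt 6"
    if x: "x \<in> W" "N x = {y, y', z}" "z \<notin> N y" "z \<notin> N y'" for x y y' z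
  proof (rule duo_le)
    have "x \<in> N z" "z \<in> W" using N_sym [of z x] x N_sub [of x] by auto
    have "y \<notin> N z" "y' \<notin> N z"
      using N_sym [of y z] N_sym [of y' z] x(3,4) \<open>z \<in> W\<close> by auto
    then have "N z \<inter> cl x = {x}" using \<open>x \<in> N z\<close> x(2) by auto
    then have "card (N z - cl x) = 2"
      using cubic [OF \<open>z \<in> W\<close>] by (subst card_Diff_subset_Int) auto
    moreover have "card (cl x \<union> (N z - cl x)) = card (cl x) + card (N z - cl x)"
      by (intro card_Un_disjoint) auto
    moreover have "card (cl x) = 4" using cubic [OF x(1)] by simp
    moreover have "card (cl x \<union> (N z - cl x)) \<le> card (cl z \<union> cl x)"
      by (intro card_mono) auto
    ultimately show "6 \<le> card (cl z \<union> cl x)" by linarith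
  qed (use x in auto)
  \<comment> \<open>If \<open>F\<close> misses the triangle, only \<open>c\<close> can block
    \<open>v\<close>, so \<open>c\<close> lies in \<open>F\<close> with a partner. Besides the four
    vertices of \<open>cl c\<close>, the excluded \<open>a\<close> and \<open>b\<close> may be
    removed too, which makes six.\<close>
  define Z where "Z = {F \<in> M. F \<inter> {v, a, b} = {}}"
  have Z: "real (card Z) \<le> 2 * wt 6"
  proof -
    define R where "R = insert a (insert b (cl c))"
    define H where "H w = {F \<in> M. F \<inter> (R \<union> cl w) = {c, w}}" for w
    have c: "c \<in> W" "v \<in> N c" using Nv N_sub [of v] N_sym [of c v] v by auto
    have "Z \<subseteq> (\<Union>w\<in>N c - {v}. H w)"
    proof
      fix F assume "F \<in> Z"
      then have F: "F \<in> M" "v \<notin> F" "a \<notin> F" "b \<notin> F" by (auto simp: Z_def)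
      have in_F: "x \<in> F" if "F \<in> solo x" for x using that by (auto simp: solo_def)
      have duo_F: "x \<in> F \<and> y \<in> F" if "F \<in> duo x y" for x y using that by (auto simp: duo_def)
      from not_mem_cases [OF F(1) v F(2)] show "F \<in> (\<Union>w\<in>N c - {v}. H w)"
      proof
        assume "\<exists>u\<in>N v. \<exists>w\<in>N u - {v}. F \<in> duo u w"
        then obtain u w where uw: "u \<in> N v" "w \<in> N u - {v}" "F \<in> duo u w" by blast
        have uwF: "u \<in> F" "w \<in> F" using duo_F [OF uw(3)] by auto
        then have "u = c" using uw(1) F Nv by auto
        moreover have "F \<inter> (cl u \<union> cl w) = {u, w}" using uw(3) by (simp add: duo_def)
        then have "F \<inter> (R \<union> cl w) = {u, w}" using F \<open>u = c\<close> by (auto simp: R_def)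
        ultimately show ?thesis using uw F by (auto simp: H_def)
      next
        assume "\<exists>u\<in>N v. \<exists>u'\<in>N v. u \<noteq> u' \<and> F \<in> solo u \<inter> solo u'"
        then show ?thesis using in_F F Nv by auto
      qed
    qed
    then have "card Z \<le> card (\<Union>w\<in>N c - {v}. H w)"
      using finite_mds [OF fin, of E] by (intro card_mono) (auto simp: H_def)
    moreover have "real (card (\<Union>w\<in>N c - {v}. H w)) \<le> real 2 * wt 6"
    proof (rule card_UN_bound)
      show "card (N c - {v}) = 2" using cubic [OF c(1)] c(2) by simp
      fix w assume w: "w \<in> N c - {v}"
      show "real (card (H w)) \<le> wt 6"
      proof (rule trace_le [of "{c, w}" "R \<union> cl w"])
        show "R \<union> cl w \<subseteq> W" unfolding R_def using W c N_sub w by blast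
        have "c \<notin> N a" "c \<notin> N b" using Na Nb Nv(2) dist by auto
        then have "a \<notin> cl c" "b \<notin> cl c"
          using N_sym [of a c] N_sym [of b c] c Nv(2) by auto
        then have "card R = 6" using cubic [OF c(1)] \<open>a \<noteq> b\<close> by (simp add: R_def)
        moreover have "card R \<le> card (R \<union> cl w)" by (intro card_mono) (auto simp: R_def)
        ultimately show "6 \<le> card (R \<union> cl w)" by simp
        show "N k \<subseteq> R \<union> cl w" if "k \<in> {c, w}" for k using that by (auto simp: R_def)
      qed (use w in \<open>auto simp: H_def R_def\<close>)
    qed simp
    ultimately show ?thesis by linarith
  qed
  let ?L = "[Z, solo v, solo a, solo b, duo a v, duo b v, duo a b, duo c v, duo a' a, duo b' b]"
  have "M \<subseteq> \<Union>(set ?L)"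
  proof
    fix F assume F: "F \<in> M"
    consider "F \<in> Z" | "v \<in> F" | "a \<in> F" | "b \<in> F" using F by (auto simp: Z_def)
    then show "F \<in> \<Union>(set ?L)"
    proof cases
      case 2
      then show ?thesis using mem_cases [OF F 2] Nv by auto
    next
      case 3
      then show ?thesis using mem_cases [OF F 3] Na by (auto simp: duo_comm)
    next
      case 4
      then show ?thesis using mem_cases [OF F 4] Nb by (auto simp: duo_comm)
    qed simp
  qed
  then have le: "real (phi W E) \<le> real (card Z) + real (card (solo v)) + real (card (solo a))
    + real (card (solo b)) + real (card (duo a v)) + real (card (duo b v)) + real (card (duo a b))
    + real (card (duo c v)) + real (card (duo a' a)) + real (card (duo b' b))"
    by (rule phi_cover [THEN order_trans]) (use finite_mds [OF fin, of E] in \<open>auto simp: Z_def\<close>)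
  have s: "real (card (solo v)) \<le> 1263 / 10000 * wt 0"
    "real (card (solo a)) \<le> 1263 / 10000 * wt 0" "real (card (solo b)) \<le> 1263 / 10000 * wt 0"
  proof -
    show "real (card (solo v)) \<le> 1263 / 10000 * wt 0"
      using Nv Na Nb dist by (intro cubic_triangle_solo [OF cubic v, of a b c a']) auto
    show "real (card (solo a)) \<le> 1263 / 10000 * wt 0"
      using Nv Na Nb dist by (intro cubic_triangle_solo [OF cubic W(1), of v b a' c]) auto
    show "real (card (solo b)) \<le> 1263 / 10000 * wt 0"
      using Nv Na Nb dist by (intro cubic_triangle_solo [OF cubic W(2), of v a b' c]) auto
  qed
  have d5: "real (card (duo a v)) \<le> wt 5" "real (card (duo b v)) \<le> wt 5" "real (card (duo a b)) \<le> wt 5"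
    using inner ab sym v W by auto
  have d6: "real (card (duo c v)) \<le> wt 6" "real (card (duo a' a)) \<le> wt 6" "real (card (duo b' b)) \<le> wt 6"
    using outer [OF v Nv(1)] outer [OF W(1) Na(1)] outer [OF W(2) Nb(1)] Nv Na Nb dist by auto
  show ?thesis using le Z s d5 d6 wt_bounds wt_pos [of 0] by linarith
qed

section \<open>The extremal graphs\<close>

lemma phi_less_or_component:
  assumes "W \<noteq> {}"
  shows "real (phi W E) < wt 0 \<or> (\<exists>v\<in>W. card (N v) = 4 \<and> (\<forall>u\<in>N v. N u \<subseteq> cl v))"
proof (rule disjCI)
  assume no: "\<not> (\<exists>v\<in>W. card (N v) = 4 \<and> (\<forall>u\<in>N v. N u \<subseteq> cl v))"
  show "real (phi W E) < wt 0"
  proof (rule ccontr)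
    assume less: "\<not> ?thesis"
    have deg: "2 \<le> card (N v) \<and> card (N v) \<le> 3" if v: "v \<in> W" for v
    proof -
      have "card (N v) \<noteq> 0" using phi_less_isolated [OF v] less by auto
      moreover have "card (N v) \<noteq> 1" using phi_pendant [OF v] less wt_pos [of 0] by auto
      moreover have "\<not> 4 \<le> card (N v)"
        using phi_less_high_degree [OF v] less no v by blast
      ultimately show ?thesis by linarith
    qed
    have out: "\<not> N u \<subseteq> cl v" if "v \<in> W" "card (N v) = 3" "u \<in> N v" for u v
      using phi_less_degree_three [OF that(1,2) deg] less that(3) by blast
    have "card (N v) \<noteq> 2" if v: "v \<in> W" for v
    proof
      assume two: "card (N v) = 2"
      have deg': "card (N u) = 2 \<or> card (N u) = 3" if "u \<in> W" for u
        using deg [OF that] by linarith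
      show False using phi_less_degree_two [OF v two deg' out] less by blast
    qed
    then have cubic: "card (N v) = 3" if "v \<in> W" for v
      using deg [OF that] that by (metis le_antisym not_less_eq_eq numeral_2_eq_2 numeral_3_eq_3)
    obtain v where "v \<in> W" using assms by blast
    then show False
      using phi_less_cubic [OF cubic out [OF _ cubic]] less by blast
  qed
qed

end

section \<open>The bound and its equality case\<close>

context graph_edges
begin

text \<open>Since \<open>E\<close> stays fixed while \<open>W\<close> shrinks, only edges inside
  \<open>W\<close> have to lie in blocks; on the full vertex set this concerns every edge.\<close>

definition K5_partition :: "'a set \<Rightarrow> 'a set set \<Rightarrow> bool" where
  "K5_partition W P \<longleftrightarrow> partition_on W P \<and> (\<forall>X\<in>P. K5_minus_matching E X) \<and>
    (\<forall>e\<in>E. e \<subseteq> W \<longrightarrow> (\<exists>X\<in>P. e \<subseteq> X))"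

lemma edge_nonempty: "e \<in> E \<Longrightarrow> e \<noteq> {}"
  using edgeD by blast

lemma phi_empty: "phi {} E = 1"
proof -
  have "mds E {} = {{}}"
    by (auto simp: mds_def maximal_dissociation_set_def dissociation_set_def)
  then show ?thesis by (simp add: phi_mds)
qed

text \<open>Bound and structure go through one induction: the only case that is not strict splits
  off a five-vertex component, and the product with the rest is tight only if both factors
  are.\<close>

lemma phi_le_and_extremal:
  "finite W \<Longrightarrow> real (phi W E) \<le> root5 ^ card W \<and>
    (real (phi W E) = root5 ^ card W \<longrightarrow> (\<exists>P. K5_partition W P))"
proof (induction W rule: finite_psubset_induct)
  case (psubset W)
  show ?case
  proof (cases "W = {}")
    case True
    have "K5_partition {} {}"
      using edge_nonempty by (auto simp: K5_partition_def partition_on_empty)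
    then show ?thesis using True by (auto simp: phi_empty)
  next
    case False
    interpret branching E W
      by unfold_locales (use psubset in auto)
    have wt0: "wt 0 = root5 ^ card W" by (simp add: wt_def)
    from phi_less_or_component [OF False] show ?thesis
    proof
      assume "real (phi W E) < wt 0"
      then show ?thesis by (simp add: wt0)
    next
      assume "\<exists>v\<in>W. card (N v) = 4 \<and> (\<forall>u\<in>N v. N u \<subseteq> cl v)"
      then obtain v where v: "v \<in> W" "card (N v) = 4" and closed: "\<And>u. u \<in> N v \<Longrightarrow> N u \<subseteq> cl v"
        by blast
      define C where "C = cl v"
      define D where "D = W - C"
      have CW: "C \<subseteq> W" using N_sub v by (auto simp: C_def)
      have C5: "card C = 5" using v by (simp add: C_def)
      have closed': "N u \<subseteq> C" if "u \<in> C" for u using that closed by (auto simp: C_def)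
      have "card W = 5 + card D"
        using C5 card_mono [OF fin CW] fin CW
        by (simp add: D_def card_Diff_subset finite_subset)
      then have pow: "root5 ^ card W = 10 * root5 ^ card D"
        by (simp add: power_add root5_power5)
      have phiW: "phi W E = phi C E * phi D E"
        unfolding D_def by (rule phi_component [OF CW closed'])
      have vC: "v \<in> C" by (simp add: C_def)
      have adj: "{u, v} \<in> E" if "u \<in> C" "u \<noteq> v" for u
        using that by (auto simp: C_def nbh_def)
      have five: "phi C E \<le> 10" "phi C E = 10 \<Longrightarrow> K5_minus_matching E C"
        using phi_five [OF C5 vC] adj by blast+
      have "D \<subset> W" using vC CW by (auto simp: D_def)
      note IH = psubset.IH [OF this]
      have le: "real (phi C E) \<le> 10" using five(1) by simp
      have "real (phi C E) * real (phi D E) \<le> 10 * root5 ^ card D"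
        using le IH by (intro mult_mono) auto
      moreover have "\<exists>P. K5_partition W P" if eq: "real (phi W E) = root5 ^ card W"
      proof -
        have pos: "root5 ^ card D > 0" using root5_pos by simp
        have prod: "real (phi C E) * real (phi D E) = 10 * root5 ^ card D"
          using eq pow phiW by simp
        \<comment> \<open>By integrality, missing 10 means at most 9, a loss the remaining factor
          cannot make up.\<close>
        have "phi C E = 10"
        proof (rule ccontr)
          assume "phi C E \<noteq> 10"
          then have "real (phi C E) \<le> 9" using five(1) by linarith
          then have "real (phi C E) * real (phi D E) \<le> 9 * root5 ^ card D"
            using IH by (intro mult_mono) auto
          then show False using prod pos by linarith
        qed
        then have K: "K5_minus_matching E C" by (rule five(2))
        have "real (phi D E) = root5 ^ card D" using prod \<open>phi C E = 10\<close> by simp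
        then obtain P where P: "K5_partition D P" using IH by blast
        have UP: "\<Union>P = D" using P by (simp add: K5_partition_def partition_on_def)
        have "partition_on W (insert C P)"
          using P CW vC UP
          by (subst partition_on_insert) (auto simp: K5_partition_def D_def disjnt_def)
        moreover have "\<exists>X\<in>insert C P. e \<subseteq> X" if e: "e \<in> E" "e \<subseteq> W" for e
        proof (cases "e \<subseteq> D")
          case True
          then show ?thesis using P e by (auto simp: K5_partition_def)
        next
          case False
          obtain x y where xy: "e = {x, y}" using edgeD [OF e(1)] by blast
          then have "x \<in> C \<or> y \<in> C" using False e(2) by (auto simp: D_def)
          moreover have "x \<in> N y" "y \<in> N x"
            using e xy by (auto simp: nbh_def insert_commute)
          ultimately have "e \<subseteq> C" using closed' [of x] closed' [of y] xy by blast
          then show ?thesis by blast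
        qed
        ultimately have "K5_partition W (insert C P)"
          using P K by (auto simp: K5_partition_def)
        then show ?thesis by blast
      qed
      ultimately show ?thesis using pow phiW by simp
    qed
  qed
qed

text \<open>The converse direction: no edge crosses between blocks, so each block contributes five
  vertices and a factor 10.\<close>

lemma K5_partition_counts:
  assumes "finite P" "K5_partition W P"
  shows "card W = 5 * card P \<and> phi W E = 10 ^ card P"
  using assms
proof (induction P arbitrary: W rule: finite_induct)
  case empty
  then show ?case by (auto simp: K5_partition_def partition_on_def phi_empty)
next
  case (insert C P)
  have part: "partition_on W (insert C P)" and K: "\<And>X. X \<in> insert C P \<Longrightarrow> K5_minus_matching E X"
    and edges: "\<And>e. e \<in> E \<Longrightarrow> e \<subseteq> W \<Longrightarrow> \<exists>X\<in>insert C P. e \<subseteq> X"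
    using insert.prems by (auto simp: K5_partition_def)
  have disj: "C \<inter> X = {}" if "X \<in> P" for X
    using part that insert.hyps(2) by (auto simp: partition_on_def dest: disjointD)
  then have "disjnt C (\<Union>P)" by (auto simp: disjnt_def)
  then have part': "partition_on (W - C) P" "C \<subseteq> W" "C \<noteq> {}"
    using part partition_on_insert by blast+
  have UP: "\<Union>P = W - C" using part'(1) by (simp add: partition_on_def)
  have K5P: "K5_partition (W - C) P"
    unfolding K5_partition_def
  proof (intro conjI ballI impI part'(1))
    show "K5_minus_matching E X" if "X \<in> P" for X using K that by simp
    fix e assume e: "e \<in> E" "e \<subseteq> W - C"
    then obtain X where X: "X \<in> insert C P" "e \<subseteq> X" using edges by blast
    then show "\<exists>X\<in>P. e \<subseteq> X" using e edge_nonempty [OF e(1)] by blast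
  qed
  note IH = insert.IH [OF K5P]
  have C5: "card C = 5" using K [of C] by (simp add: K5_minus_matching_def)
  have finC: "finite C" using C5 by (simp add: card_ge_0_finite)
  have fin': "finite (W - C)"
  proof -
    have "finite X" if "X \<in> P" for X
      using K [of X] that by (simp add: K5_minus_matching_def card_ge_0_finite)
    then show ?thesis unfolding UP [symmetric] using insert.hyps(1) by blast
  qed
  have W: "W = C \<union> (W - C)" using part'(2) by blast
  have "card W = card C + card (W - C)"
    using finC fin' by (subst W, intro card_Un_disjoint) auto
  moreover have "phi W E = phi C E * phi (W - C) E"
  proof (subst W, rule phi_Un [OF finC fin'])
    fix x y assume xy: "x \<in> C" "y \<in> W - C"
    show "{x, y} \<notin> E"
    proof
      assume "{x, y} \<in> E"
      then obtain X where X: "X \<in> insert C P" "{x, y} \<subseteq> X" using edges [of "{x, y}"] xy part'(2) by blast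
      then show False using disj [of X] xy by blast
    qed
  qed blast
  moreover have "phi C E = 10" by (rule phi_K5_minus_matching) (use K in auto)
  ultimately show ?case using IH C5 insert.hyps by simp
qed

end

theorem theorem1p1:
  fixes V :: "'a set" and E :: "'a set set" and n :: nat
  assumes "simple_graph V E" and "n = card V"
  shows "real (phi V E) \<le> 10 powr (real n / 5) \<and>
    (real (phi V E) = 10 powr (real n / 5) \<longleftrightarrow>
      n mod 5 = 0 \<and>
      (\<exists>P. partition_on V P \<and> card P = n div 5 \<and>
           (\<forall>X\<in>P. K5_minus_matching E X) \<and>
           (\<forall>e\<in>E. \<exists>X\<in>P. e \<subseteq> X)))"
proof -
  have fin: "finite V" and EV: "\<And>e. e \<in> E \<Longrightarrow> \<exists>u v. e = {u, v} \<and> u \<noteq> v \<and> u \<in> V \<and> v \<in> V"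
    using assms(1) by (auto simp: simple_graph_def)
  interpret graph_edges E
    by unfold_locales (use EV in blast)
  have sub: "e \<subseteq> V" if "e \<in> E" for e using EV [OF that] by auto
  have part: "K5_partition V P \<longleftrightarrow> partition_on V P \<and> (\<forall>X\<in>P. K5_minus_matching E X) \<and>
    (\<forall>e\<in>E. \<exists>X\<in>P. e \<subseteq> X)" for P
    using sub by (auto simp: K5_partition_def)
  have bound: "10 powr (real n / 5) = root5 ^ card V"
    by (simp add: root5_power assms(2))
  have counts: "card V = 5 * card P" "phi V E = 10 ^ card P" if "K5_partition V P" for P
  proof -
    have "finite P" using fin that finite_elements by (auto simp: K5_partition_def)
    then show "card V = 5 * card P" "phi V E = 10 ^ card P"
      using K5_partition_counts that by auto
  qed
  have eq: "real (phi V E) = root5 ^ card V" if "K5_partition V P" for P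
    using counts [OF that] by (simp add: power_mult root5_power5)
  have "real (phi V E) = root5 ^ card V \<longleftrightarrow>
    n mod 5 = 0 \<and> (\<exists>P. K5_partition V P \<and> card P = n div 5)"
  proof
    assume "real (phi V E) = root5 ^ card V"
    then obtain P where P: "K5_partition V P" using phi_le_and_extremal [OF fin] by blast
    then have "n = 5 * card P" using counts(1) assms(2) by simp
    then show "n mod 5 = 0 \<and> (\<exists>P. K5_partition V P \<and> card P = n div 5)" using P by auto
  qed (use eq in blast)
  then show ?thesis
    using phi_le_and_extremal [OF fin] unfolding bound part by (auto simp: conj_ac)
qed

end
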